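(* Let $T:l_\infty\to l_\infty$ be a continuous positive linear map with adjoint $T^*$, let $F=\{p\in\Delta^\sigma: p\text{ is an eigenvector of }T^*\}$ and let $\overline F$ be its weak$^\star$ closure. If $\succsim$ satisfies Weak order, Monotonicity, Continuity, ICRP, Convexity, Monotone continuity and I$T$IS, then there exists a grounded, weak$^\star$-lower semicontinuous function $c:\overline F\to[0,\infty]$ with $c(p)=\infty$ for all $p\in\overline F\setminus F$, such that $$I(x)=\min_{p\in\overline F}\{\langle x,p\rangle+c(p)\}$$ (equivalently, the minimum over $p\in F$ of $\sum_{n\ge0}p_nx_n+c(p)$) is the unique constant equivalent representing $\succsim$. Conversely, if $I$ has this form for some such $c$ and $\langle1,T^*(p)\rangle\le1$ for every $p\in F$, then the relation represented by $I$ satisfies Weak order, Monotonicity, Continuity, ICRP, Convexity, Monotone continuity and I$T$IS.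
   Context: $l_\infty$: real bounded sequences indexed by $\mathbb N$; $\theta\in\mathbb R$ also a constant sequence; $x\ge y$ coordinatewise. $ba(\mathbb N)$: norm dual of $l_\infty$, pairing $\langle x,\mu\rangle$, weak$^\star$ topology. Adjoint: $\langle x,T^*(\mu)\rangle=\langle T(x),\mu\rangle$. $\Delta$: finitely additive probability measures on $2^{\mathbb N}$; $\Delta^\sigma\subseteq\Delta$: countably additive ones, identified with $(p_n)$, $p_n=p(\{n\})\ge0$, $\sum p_n=1$. Eigenvector: nonzero $\mu$ with $T^*\mu=\lambda\mu$ for some real $\lambda$. Grounded: infimum $0$. Constant equivalent: $I$ with $x\sim I(x)$, $x\succsim y\iff I(x)\ge I(y)$. $xAy$ equals $x$ on $A$, $y$ off $A$; $(E_n)\downarrow\emptyset$: decreasing with empty intersection. Weak order: complete, transitive. Monotonicity: $x\ge y\Rightarrow x\succsim y$, $1\succ0$. Continuity: for $x\succsim y\succsim z$ the sets $\{\alpha\in[0,1]:\alpha x+(1-\alpha)z\succsim y\}$, $\{\alpha:y\succsim\alpha x+(1-\alpha)z\}$ are closed. ICRP: $x\succsim y\Rightarrow x+\theta\succsim y+\theta$. Convexity: $x\succsim\theta,y\succsim\theta\Rightarrow\lambda x+(1-\lambda)y\succsim\theta$. Monotone continuity: if $x\succ\theta$ and $(E_n)\downarrow\emptyset$, then for every $k\in\mathbb R$ there is $n_0$ with $kE_{n_0}x\succ\theta$. I$T$IS: $x+d\succsim x\Rightarrow x+T(d)\succsim x$. *)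

theory Defs
  imports "HOL-Analysis.Analysis"
begin

definition linf :: "(nat \<Rightarrow> real) set" where
  "linf = {x. bounded (range x)}"

definition supn :: "(nat \<Rightarrow> real) \<Rightarrow> real" where
  "supn x = (SUP n. \<bar>x n\<bar>)"

definition pair :: "(nat \<Rightarrow> real) \<Rightarrow> (nat \<Rightarrow> real) \<Rightarrow> real" where
  "pair x p = (\<Sum>n. p n * x n)"

(* Delta^sigma: countably additive probabilities on 2^N, identified with (p_n) *)
definition DeltaSigma :: "(nat \<Rightarrow> real) set" where
  "DeltaSigma = {p. (\<forall>n. 0 \<le> p n) \<and> summable p \<and> suminf p = 1}"

(* ba(N) = norm dual of l_infty; a functional is represented by its values on l_infty,
   normalised to 0 outside l_infty *)
definition ba :: "((nat \<Rightarrow> real) \<Rightarrow> real) set" where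
  "ba = {\<mu>. (\<forall>x\<in>linf. \<forall>y\<in>linf. \<mu> (\<lambda>n. x n + y n) = \<mu> x + \<mu> y)
          \<and> (\<forall>a. \<forall>x\<in>linf. \<mu> (\<lambda>n. a * x n) = a * \<mu> x)
          \<and> (\<exists>C. \<forall>x\<in>linf. \<bar>\<mu> x\<bar> \<le> C * supn x)
          \<and> (\<forall>x. x \<notin> linf \<longrightarrow> \<mu> x = 0)}"

definition embed :: "(nat \<Rightarrow> real) \<Rightarrow> ((nat \<Rightarrow> real) \<Rightarrow> real)" where
  "embed p = (\<lambda>x. if x \<in> linf then pair x p else 0)"

definition adjoint :: "((nat \<Rightarrow> real) \<Rightarrow> (nat \<Rightarrow> real)) \<Rightarrow>
    ((nat \<Rightarrow> real) \<Rightarrow> real) \<Rightarrow> ((nat \<Rightarrow> real) \<Rightarrow> real)" where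
  "adjoint T \<mu> = (\<lambda>x. if x \<in> linf then \<mu> (T x) else 0)"

definition eigenvector :: "((nat \<Rightarrow> real) \<Rightarrow> (nat \<Rightarrow> real)) \<Rightarrow>
    ((nat \<Rightarrow> real) \<Rightarrow> real) \<Rightarrow> bool" where
  "eigenvector T \<mu> \<longleftrightarrow> \<mu> \<in> ba \<and> \<mu> \<noteq> (\<lambda>_. 0) \<and> (\<exists>r::real. adjoint T \<mu> = (\<lambda>x. r * \<mu> x))"

definition cont_pos_linear :: "((nat \<Rightarrow> real) \<Rightarrow> (nat \<Rightarrow> real)) \<Rightarrow> bool" where
  "cont_pos_linear T \<longleftrightarrow>
     (\<forall>x\<in>linf. T x \<in> linf)
   \<and> (\<forall>x\<in>linf. \<forall>y\<in>linf. T (\<lambda>n. x n + y n) = (\<lambda>n. T x n + T y n))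
   \<and> (\<forall>a. \<forall>x\<in>linf. T (\<lambda>n. a * x n) = (\<lambda>n. a * T x n))
   \<and> (\<forall>x\<in>linf. (\<forall>n. 0 \<le> x n) \<longrightarrow> (\<forall>n. 0 \<le> T x n))
   \<and> (\<exists>C. \<forall>x\<in>linf. supn (T x) \<le> C * supn x)"

definition Fset :: "((nat \<Rightarrow> real) \<Rightarrow> (nat \<Rightarrow> real)) \<Rightarrow> ((nat \<Rightarrow> real) \<Rightarrow> real) set" where
  "Fset T = embed ` {p \<in> DeltaSigma. eigenvector T (embed p)}"

(* weak* closure: on functionals vanishing off l_infty, the product (pointwise)
   topology on (nat => real) => real is exactly the weak* topology *)
definition Fbar :: "((nat \<Rightarrow> real) \<Rightarrow> (nat \<Rightarrow> real)) \<Rightarrow> ((nat \<Rightarrow> real) \<Rightarrow> real) set" where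
  "Fbar T = closure (Fset T)"

definition cost_ok :: "((nat \<Rightarrow> real) \<Rightarrow> (nat \<Rightarrow> real)) \<Rightarrow> (((nat \<Rightarrow> real) \<Rightarrow> real) \<Rightarrow> ereal) \<Rightarrow> bool" where
  "cost_ok T c \<longleftrightarrow>
     (\<forall>\<phi>\<in>Fbar T. 0 \<le> c \<phi>)
   \<and> (INF \<phi>\<in>Fbar T. c \<phi>) = 0
   \<and> (\<forall>t::real. closed {\<phi> \<in> Fbar T. c \<phi> \<le> ereal t})
   \<and> (\<forall>\<phi>\<in>Fbar T - Fset T. c \<phi> = \<infinity>)"

definition min_rep :: "((nat \<Rightarrow> real) \<Rightarrow> (nat \<Rightarrow> real)) \<Rightarrow> (((nat \<Rightarrow> real) \<Rightarrow> real) \<Rightarrow> ereal)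
    \<Rightarrow> ((nat \<Rightarrow> real) \<Rightarrow> real) \<Rightarrow> bool" where
  "min_rep T c I \<longleftrightarrow> (\<forall>x\<in>linf.
      ereal (I x) = (INF \<phi>\<in>Fbar T. ereal (\<phi> x) + c \<phi>)
    \<and> (\<exists>\<phi>\<in>Fbar T. ereal (\<phi> x) + c \<phi> = ereal (I x)))"

type_synonym pref = "(nat \<Rightarrow> real) \<Rightarrow> (nat \<Rightarrow> real) \<Rightarrow> bool"

definition strict :: "pref \<Rightarrow> (nat \<Rightarrow> real) \<Rightarrow> (nat \<Rightarrow> real) \<Rightarrow> bool" where
  "strict R x y \<longleftrightarrow> R x y \<and> \<not> R y x"

definition weak_order :: "pref \<Rightarrow> bool" where
  "weak_order R \<longleftrightarrow> (\<forall>x\<in>linf. \<forall>y\<in>linf. R x y \<or> R y x)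
     \<and> (\<forall>x\<in>linf. \<forall>y\<in>linf. \<forall>z\<in>linf. R x y \<and> R y z \<longrightarrow> R x z)"

definition monotonicity :: "pref \<Rightarrow> bool" where
  "monotonicity R \<longleftrightarrow> (\<forall>x\<in>linf. \<forall>y\<in>linf. (\<forall>n. y n \<le> x n) \<longrightarrow> R x y)
     \<and> strict R (\<lambda>_. 1) (\<lambda>_. 0)"

definition continuity :: "pref \<Rightarrow> bool" where
  "continuity R \<longleftrightarrow> (\<forall>x\<in>linf. \<forall>y\<in>linf. \<forall>z\<in>linf. R x y \<and> R y z \<longrightarrow>
       closed {\<alpha>\<in>{0..1}. R (\<lambda>n. \<alpha> * x n + (1 - \<alpha>) * z n) y}
     \<and> closed {\<alpha>\<in>{0..1}. R y (\<lambda>n. \<alpha> * x n + (1 - \<alpha>) * z n)})"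

definition icrp :: "pref \<Rightarrow> bool" where
  "icrp R \<longleftrightarrow> (\<forall>x\<in>linf. \<forall>y\<in>linf. \<forall>\<theta>::real.
       R x y \<longrightarrow> R (\<lambda>n. x n + \<theta>) (\<lambda>n. y n + \<theta>))"

definition convexity :: "pref \<Rightarrow> bool" where
  "convexity R \<longleftrightarrow> (\<forall>x\<in>linf. \<forall>y\<in>linf. \<forall>\<theta>::real. \<forall>t\<in>{0..1::real}.
       R x (\<lambda>_. \<theta>) \<and> R y (\<lambda>_. \<theta>) \<longrightarrow> R (\<lambda>n. t * x n + (1 - t) * y n) (\<lambda>_. \<theta>))"

definition monotone_continuity :: "pref \<Rightarrow> bool" where
  "monotone_continuity R \<longleftrightarrow> (\<forall>x\<in>linf. \<forall>\<theta>::real. \<forall>E::nat \<Rightarrow> nat set.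
       strict R x (\<lambda>_. \<theta>) \<and> (\<forall>n. E (Suc n) \<subseteq> E n) \<and> (\<Inter>n. E n) = {} \<longrightarrow>
       (\<forall>k::real. \<exists>n0. strict R (\<lambda>i. if i \<in> E n0 then k else x i) (\<lambda>_. \<theta>)))"

definition ITIS :: "((nat \<Rightarrow> real) \<Rightarrow> (nat \<Rightarrow> real)) \<Rightarrow> pref \<Rightarrow> bool" where
  "ITIS T R \<longleftrightarrow> (\<forall>x\<in>linf. \<forall>d\<in>linf.
       R (\<lambda>n. x n + d n) x \<longrightarrow> R (\<lambda>n. x n + T d n) x)"

definition all_axioms :: "((nat \<Rightarrow> real) \<Rightarrow> (nat \<Rightarrow> real)) \<Rightarrow> pref \<Rightarrow> bool" where
  "all_axioms T R \<longleftrightarrow> weak_order R \<and> monotonicity R \<and> continuity R \<and> icrp R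
     \<and> convexity R \<and> monotone_continuity R \<and> ITIS T R"

definition const_equiv :: "pref \<Rightarrow> ((nat \<Rightarrow> real) \<Rightarrow> real) \<Rightarrow> bool" where
  "const_equiv R I \<longleftrightarrow> (\<forall>x\<in>linf. R x (\<lambda>_. I x) \<and> R (\<lambda>_. I x) x)
     \<and> (\<forall>x\<in>linf. \<forall>y\<in>linf. R x y \<longleftrightarrow> I y \<le> I x)"

end

theory Submission
  imports Defs
begin

text \<open>
  The axioms make the constant equivalent \<open>I\<close> monotone, translation invariant and concave, and the
  cost is its conjugate \<open>c \<phi> = sup\<^sub>x (I x - \<phi> x)\<close>; monotone continuity forces \<open>\<phi>\<close> to be countably
  additive where \<open>c\<close> is finite. The point is that every \<open>x\<close> has a supergradient of \<open>I\<close> that is an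
  eigenvector of the adjoint of \<open>T\<close>. The ITIS axiom says that the directional derivative \<open>J\<close> of \<open>I\<close>
  at \<open>x\<close> satisfies \<open>J d \<ge> 0 \<Longrightarrow> J (T d) \<ge> 0\<close>, i.e. the adjoint preserves the cone spanned by the
  superdifferential, and a Krein-Rutman argument using only the Hahn-Banach theorem yields an
  eigenvector in that cone.

  Conversely, a minimizing \<open>\<phi>\<close> has eigenvalue \<open>r \<in> [0, 1]\<close>, so the bound for \<open>I (x + T d)\<close> is a
  convex combination of those for \<open>I x\<close> and \<open>I (x + d)\<close>; monotone continuity follows from weak*
  compactness of the sublevel sets of \<open>c\<close>.
\<close>

section \<open>Superlinear functionals and the Hahn-Banach theorem\<close>

definition superlinear :: "('a::real_vector \<Rightarrow> real) \<Rightarrow> bool" where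
  "superlinear J \<longleftrightarrow> (\<forall>x y. J x + J y \<le> J (x + y)) \<and> (\<forall>t>0. \<forall>x. J (t *\<^sub>R x) = t * J x)"

text \<open>One inequality in homogeneity suffices: applied to \<open>1 / t\<close> and
  \<open>t *\<^sub>R x\<close> it gives the reverse one.\<close>

lemma superlinearI:
  assumes "\<And>x y. J x + J y \<le> J (x + y)"
    and half: "\<And>t x. 0 < t \<Longrightarrow> t * J x \<le> J (t *\<^sub>R x)"
  shows "superlinear J"
proof -
  have "J (t *\<^sub>R x) = t * J x" if t: "0 < t" for t x
  proof (rule antisym)
    show "J (t *\<^sub>R x) \<le> t * J x"
      using half[of "1 / t" "t *\<^sub>R x"] t by (simp add: field_simps)
  qed (use half t in auto)
  with assms(1) show ?thesis unfolding superlinear_def by blast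
qed

lemma superlinear_add: "superlinear J \<Longrightarrow> J x + J y \<le> J (x + y)"
  by (simp add: superlinear_def)

lemma superlinear_zero: assumes "superlinear J" shows "J 0 = 0"
proof -
  have "J (2 *\<^sub>R 0) = 2 * J 0"
    using assms unfolding superlinear_def by (metis zero_less_numeral)
  then show ?thesis by simp
qed

lemma superlinear_scale: "superlinear J \<Longrightarrow> 0 \<le> t \<Longrightarrow> J (t *\<^sub>R x) = t * J x"
  using superlinear_zero[of J] by (cases "t = 0") (auto simp: superlinear_def)

lemma superlinear_uminus: assumes "superlinear J" shows "J x \<le> - J (- x)"
  using superlinear_add[OF assms, of x "- x"] superlinear_zero[OF assms] by simp

text \<open>\<open>P\<close> is the sup-convolution of \<open>Q\<close> with \<open>g\<close> over
  the cone \<open>C\<close>. Since \<open>- g c \<le> P (- c)\<close>, every linear functional above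
  \<open>P\<close> is at most \<open>g\<close> on \<open>C\<close>. It is used with \<open>C\<close>
  a ray and with \<open>C\<close> a subspace.\<close>

lemma superlinear_extend:
  fixes Q :: "'a::real_vector \<Rightarrow> real"
  assumes Q: "superlinear Q"
    and C0: "0 \<in> C" "g 0 = 0"
    and Cadd: "\<And>a b. a \<in> C \<Longrightarrow> b \<in> C \<Longrightarrow> a + b \<in> C \<and> g (a + b) = g a + g b"
    and Csc: "\<And>t a. 0 < t \<Longrightarrow> a \<in> C \<Longrightarrow> t *\<^sub>R a \<in> C \<and> g (t *\<^sub>R a) = t * g a"
    and le: "\<And>a. a \<in> C \<Longrightarrow> Q a \<le> g a"
  obtains P where "superlinear P" "\<And>y. Q y \<le> P y" "\<And>y c. c \<in> C \<Longrightarrow> Q (y + c) - g c \<le> P y"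
proof
  define P where "P = (\<lambda>y. SUP c\<in>C. Q (y + c) - g c)"
  \<comment> \<open>This bound is independent of \<open>c\<close>, so the supremum is finite:
    \<open>Q (y + c) + Q (- y) \<le> Q c \<le> g c\<close>.\<close>
  have ub: "Q (y + c) - g c \<le> - Q (- y)" if "c \<in> C" for y c
    using superlinear_add[OF Q, of "y + c" "- y"] le[OF that] by simp
  have bdd: "bdd_above ((\<lambda>c. Q (y + c) - g c) ` C)" for y
    using ub by (intro bdd_aboveI2) auto
  show upper: "Q (y + c) - g c \<le> P y" if "c \<in> C" for y c
    unfolding P_def using that by (intro cSUP_upper bdd)
  show "Q y \<le> P y" for y
    using upper[OF C0(1), of y] C0(2) by simp
  have least: "P y \<le> z" if "\<And>c. c \<in> C \<Longrightarrow> Q (y + c) - g c \<le> z" for y z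
    unfolding P_def using that C0(1) by (intro cSUP_least) auto
  have add: "P x + P y \<le> P (x + y)" for x y
  proof -
    have "P x \<le> P (x + y) - P y"
    proof (rule least)
      fix a assume a: "a \<in> C"
      have "P y \<le> P (x + y) - (Q (x + a) - g a)"
      proof (rule least)
        fix b assume b: "b \<in> C"
        have "Q (x + a) + Q (y + b) \<le> Q ((x + y) + (a + b))"
          using superlinear_add[OF Q, of "x + a" "y + b"] by (simp add: algebra_simps)
        then show "Q (y + b) - g b \<le> P (x + y) - (Q (x + a) - g a)"
          using upper[of "a + b" "x + y"] Cadd[OF a b] by simp
      qed
      then show "Q (x + a) - g a \<le> P (x + y) - P y" by simp
    qed
    then show ?thesis by simp
  qed
  have half: "t * P x \<le> P (t *\<^sub>R x)" if t: "t > 0" for t x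
  proof -
    have "P x \<le> P (t *\<^sub>R x) / t"
    proof (rule least)
      fix a assume a: "a \<in> C"
      have "Q (t *\<^sub>R x + t *\<^sub>R a) = t * Q (x + a)"
        using superlinear_scale[OF Q, of t "x + a"] t by (simp add: scaleR_add_right)
      then have "t * (Q (x + a) - g a) \<le> P (t *\<^sub>R x)"
        using upper[of "t *\<^sub>R a" "t *\<^sub>R x"] Csc[OF t a] by (simp add: algebra_simps)
      then show "Q (x + a) - g a \<le> P (t *\<^sub>R x) / t"
        using t by (simp add: field_simps)
    qed
    then show ?thesis using t by (simp add: field_simps)
  qed
  show "superlinear P" by (rule superlinearI[OF add half])
qed

text \<open>The upper bound needed for Zorn's lemma. Superlinearity and \<open>J \<le> Q\<close>
  bound all members at \<open>x\<close> by \<open>- J (- x)\<close>; superadditivity survives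
  because two members of a chain are dominated by one of them.\<close>

lemma superlinear_chain_SUP:
  fixes \<C> :: "('a::real_vector \<Rightarrow> real) set"
  assumes ne: "\<C> \<noteq> {}" and sl: "\<And>Q. Q \<in> \<C> \<Longrightarrow> superlinear Q"
    and ge: "\<And>Q. Q \<in> \<C> \<Longrightarrow> J \<le> Q"
    and ch: "\<And>P Q. P \<in> \<C> \<Longrightarrow> Q \<in> \<C> \<Longrightarrow> P \<le> Q \<or> Q \<le> P"
  shows "superlinear (\<lambda>x. SUP Q\<in>\<C>. Q x)" "\<And>Q x. Q \<in> \<C> \<Longrightarrow> Q x \<le> (SUP Q\<in>\<C>. Q x)"
proof -
  define P where "P = (\<lambda>x. SUP Q\<in>\<C>. Q x)"
  have bdd: "bdd_above ((\<lambda>Q. Q x) ` \<C>)" for x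
  proof (rule bdd_aboveI2)
    fix Q assume "Q \<in> \<C>"
    then show "Q x \<le> - J (- x)"
      using superlinear_uminus[OF sl, of Q x] le_funD[OF ge, of Q "- x"] by simp
  qed
  show upper: "Q x \<le> (SUP Q\<in>\<C>. Q x)" if "Q \<in> \<C>" for Q x
    using that by (intro cSUP_upper bdd)
  have least: "P x \<le> z" if "\<And>Q. Q \<in> \<C> \<Longrightarrow> Q x \<le> z" for x z
    unfolding P_def using that ne by (intro cSUP_least) auto
  have add: "P x + P y \<le> P (x + y)" for x y
  proof -
    have "P x \<le> P (x + y) - P y"
    proof (rule least)
      fix A assume A: "A \<in> \<C>"
      have "P y \<le> P (x + y) - A x"
      proof (rule least)
        fix B assume B: "B \<in> \<C>"
        obtain D where D: "D \<in> \<C>" "A \<le> D" "B \<le> D"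
          using ch[OF A B] A B by blast
        have "A x + B y \<le> D x + D y"
          using D by (intro add_mono) (auto dest: le_funD)
        also have "\<dots> \<le> D (x + y)"
          using superlinear_add[OF sl] D by blast
        also have "\<dots> \<le> P (x + y)"
          unfolding P_def by (rule upper[OF D(1)])
        finally show "B y \<le> P (x + y) - A x" by simp
      qed
      then show "A x \<le> P (x + y) - P y" by simp
    qed
    then show ?thesis by simp
  qed
  have half: "t * P x \<le> P (t *\<^sub>R x)" if t: "t > 0" for t x
  proof -
    have "P x \<le> P (t *\<^sub>R x) / t"
    proof (rule least)
      fix A assume A: "A \<in> \<C>"
      then show "A x \<le> P (t *\<^sub>R x) / t"
        using upper[OF A, of "t *\<^sub>R x"] superlinear_scale[OF sl[OF A], of t x] t
        by (simp add: field_simps P_def)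
    qed
    then show ?thesis using t by (simp add: field_simps)
  qed
  have "superlinear P" by (rule superlinearI[OF add half])
  then show "superlinear (\<lambda>x. SUP Q\<in>\<C>. Q x)" by (simp add: P_def)
qed

text \<open>Zorn's lemma gives a maximal superlinear functional above \<open>J\<close>. Maximality
  makes it additive, since extending it along a ray cannot enlarge it.\<close>

lemma Hahn_Banach_superlinear:
  fixes J :: "'a::real_vector \<Rightarrow> real"
  assumes J: "superlinear J"
  obtains p where "linear p" "\<And>x. J x \<le> p x"
proof -
  define S where "S = {Q. superlinear Q \<and> J \<le> Q}"
  have "\<exists>Q\<in>S. \<forall>P\<in>S. Q \<le> P \<longrightarrow> P = Q"
  proof (rule predicate_Zorn)
    show "partial_order_on S (relation_of (\<le>) S)"
      by (rule partial_order_on_relation_ofI) auto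
    fix \<C> assume "\<C> \<in> Chains (relation_of (\<le>) S)"
    then have sub: "\<C> \<subseteq> S" and ch: "\<And>P Q. P \<in> \<C> \<Longrightarrow> Q \<in> \<C> \<Longrightarrow> P \<le> Q \<or> Q \<le> P"
      by (auto simp: Chains_def relation_of_def)
    show "\<exists>u\<in>S. \<forall>a\<in>\<C>. a \<le> u"
    proof (cases "\<C> = {}")
      case True
      then show ?thesis using J by (auto simp: S_def)
    next
      case False
      have sl: "\<And>Q. Q \<in> \<C> \<Longrightarrow> superlinear Q" and ge: "\<And>Q. Q \<in> \<C> \<Longrightarrow> J \<le> Q"
        using sub by (auto simp: S_def)
      note sup = superlinear_chain_SUP[of \<C> J, OF False sl ge ch]
      have "(\<lambda>x. SUP Q\<in>\<C>. Q x) \<in> S"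
      proof -
        obtain Q where "Q \<in> \<C>" using False by blast
        then have "J \<le> (\<lambda>x. SUP Q\<in>\<C>. Q x)"
          using sup(2) ge by (fastforce simp: le_fun_def intro: order_trans)
        with sup(1) show ?thesis by (simp add: S_def)
      qed
      then show ?thesis
        by (rule bexI[rotated]) (use sup(2) in \<open>auto simp: le_fun_def\<close>)
    qed
  qed
  then obtain Q where Q: "superlinear Q" "J \<le> Q"
    and max: "\<And>P. superlinear P \<Longrightarrow> J \<le> P \<Longrightarrow> Q \<le> P \<Longrightarrow> P = Q"
    by (auto simp: S_def)
  have add: "Q (x + y) = Q x + Q y" for x y
  proof (rule antisym)
    \<comment> \<open>With \<open>C\<close> the ray through \<open>y\<close> and
      \<open>g = Q\<close>, the extension satisfies \<open>Q (x + y) - Q y \<le> P x\<close>;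
      maximality turns \<open>P x\<close> into \<open>Q x\<close>.\<close>
    define C where "C = {t *\<^sub>R y | t. 0 \<le> t}"
    obtain P where P: "superlinear P" "\<And>z. Q z \<le> P z" "\<And>z c. c \<in> C \<Longrightarrow> Q (z + c) - Q c \<le> P z"
    proof (rule superlinear_extend[OF Q(1), of C Q])
      show "0 \<in> C" unfolding C_def by (rule CollectI, rule exI[of _ 0]) simp
      show "a + b \<in> C \<and> Q (a + b) = Q a + Q b" if ab: "a \<in> C" "b \<in> C" for a b
      proof -
        obtain s t where st: "a = s *\<^sub>R y" "b = t *\<^sub>R y" "0 \<le> s" "0 \<le> t"
          using ab by (auto simp: C_def)
        then have "a + b = (s + t) *\<^sub>R y" by (simp add: scaleR_add_left)
        moreover have "Q ((s + t) *\<^sub>R y) = Q a + Q b"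
          using st superlinear_scale[OF Q(1)] by (simp add: distrib_right)
        ultimately show ?thesis using st by (auto simp: C_def)
      qed
      show "t *\<^sub>R a \<in> C \<and> Q (t *\<^sub>R a) = t * Q a" if t: "0 < t" and a: "a \<in> C" for t a
      proof -
        from a obtain s where s: "a = s *\<^sub>R y" "0 \<le> s" by (auto simp: C_def)
        then have "t *\<^sub>R a = (t * s) *\<^sub>R y" "0 \<le> t * s" using t by auto
        then show ?thesis using superlinear_scale[OF Q(1), of t a] t by (auto simp: C_def)
      qed
    qed (use superlinear_zero[OF Q(1)] in auto)
    have "P = Q"
      using max[OF P(1)] P(2) Q(2) by (auto simp: le_fun_def intro: order_trans)
    moreover have "y \<in> C"
      unfolding C_def by (rule CollectI, rule exI[of _ 1]) simp
    ultimately show "Q (x + y) \<le> Q x + Q y"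
      using P(3)[of y x] by simp
  qed (rule superlinear_add[OF Q(1)])
  have "Q (- x) = - Q x" for x
    using add[of x "- x"] superlinear_zero[OF Q(1)] by simp
  then have "Q (t *\<^sub>R x) = t *\<^sub>R Q x" for t x
    using superlinear_scale[OF Q(1), of t x] superlinear_scale[OF Q(1), of "- t" "- x"]
    by (cases "0 \<le> t") auto
  with add have "linear Q" by (intro linearI)
  with Q(2) show ?thesis
    using that[of Q] by (auto simp: le_fun_def)
qed

lemma Hahn_Banach_annihilator:
  fixes J :: "'a::real_vector \<Rightarrow> real"
  assumes J: "superlinear J" and M: "subspace M" "\<And>m. m \<in> M \<Longrightarrow> J m \<le> 0"
  obtains p where "linear p" "\<And>x. J x \<le> p x" "\<And>m. m \<in> M \<Longrightarrow> p m = 0"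
proof -
  obtain P where P: "superlinear P" "\<And>y. J y \<le> P y" "\<And>y c. c \<in> M \<Longrightarrow> J (y + c) - 0 \<le> P y"
    by (rule superlinear_extend[OF J, of M "\<lambda>_. 0"])
      (use M subspace_0 subspace_add subspace_scale in auto)
  obtain p where p: "linear p" "\<And>x. P x \<le> p x"
    using Hahn_Banach_superlinear[OF P(1)] by blast
  \<comment> \<open>Taking \<open>y = m\<close> and \<open>c = - m\<close> gives
    \<open>0 = J 0 \<le> P m \<le> p m\<close>.\<close>
  have ge: "0 \<le> p m" if "m \<in> M" for m
    using P(3)[of "- m" m] p(2)[of m] P(3)[of m "- m"] superlinear_zero[OF J] that subspace_neg[OF M(1), of m]
    by simp
  have "p m = 0" if "m \<in> M" for m
    using ge[OF that] ge[of "- m"] subspace_neg[OF M(1) that] linear_neg[OF p(1), of m] by simp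
  then show ?thesis
    using that[of p] p P(2) order_trans by blast
qed

text \<open>Continuity along a line at \<open>x\<close>, from the bound
  \<open>J (s *\<^sub>R y) \<ge> - \<bar>s\<bar> * B\<close>; it allows small perturbations of
  strict inequalities.\<close>

lemma superlinear_line_cont:
  assumes J: "superlinear J" and pos: "0 < J (x::'a::real_vector)"
  obtains \<epsilon> where "\<epsilon> > 0" "\<And>s. \<bar>s\<bar> \<le> \<epsilon> \<Longrightarrow> 0 < J (x + s *\<^sub>R y)"
proof
  define B where "B = \<bar>J y\<bar> + \<bar>J (- y)\<bar> + 1"
  have B: "B > 0" unfolding B_def by simp
  show "J x / (2 * B) > 0" using B pos by simp
  fix s assume s: "\<bar>s\<bar> \<le> J x / (2 * B)"
  have "J (s *\<^sub>R y) \<ge> - (\<bar>s\<bar> * B)"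
  proof (cases "0 \<le> s")
    case True
    have "s * J y \<ge> s * (- B)" using True unfolding B_def by (intro mult_left_mono) auto
    then show ?thesis using True superlinear_scale[OF J True, of y] by simp
  next
    case False
    then have "(- s) * J (- y) \<ge> (- s) * (- B)" unfolding B_def by (intro mult_left_mono) auto
    then show ?thesis using False superlinear_scale[OF J, of "- s" "- y"] by simp
  qed
  moreover have "\<bar>s\<bar> * B \<le> J x / 2"
    using s B by (simp add: field_simps)
  ultimately show "0 < J (x + s *\<^sub>R y)"
    using superlinear_add[OF J, of x "s *\<^sub>R y"] pos by linarith
qed

text \<open>
  A form of the Krein-Rutman theorem. The number \<open>r\<close> is the infimum of all \<open>l \<ge> 0\<close> such that
  \<open>J (l u - T u) > 0\<close> for some \<open>u\<close> with \<open>J u \<ge> 0\<close> (a Collatz-Wielandt bound); minimality of \<open>r\<close>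
  forces \<open>J \<le> 0\<close> on the range of \<open>T - r\<close>, so Hahn-Banach gives \<open>p\<close> vanishing on that range.
\<close>

lemma superlinear_positive_eigenfunctional:
  fixes J :: "'a::real_vector \<Rightarrow> real"
  assumes J: "superlinear J" and e: "0 < J e" and T: "linear T"
    and inv: "\<And>d. 0 \<le> J d \<Longrightarrow> 0 \<le> J (T d)"
  obtains p r where "linear p" "\<And>x. J x \<le> p x" "\<And>x. p (T x) = r * p x"
proof -
  define A where "A = {l. 0 \<le> l \<and> (\<exists>u. 0 \<le> J u \<and> 0 < J (l *\<^sub>R u - T u))}"
  define r where "r = Inf A"
  note add = superlinear_add[OF J] and sc = superlinear_scale[OF J]
  have bdd: "bdd_below A" by (intro bdd_belowI[of _ 0]) (simp add: A_def)
  \<comment> \<open>For \<open>u = e\<close>, the factor \<open>l\<close> is large enough that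
    \<open>l * J e\<close> outweighs \<open>J (- T e)\<close>.\<close>
  have ne: "A \<noteq> {}"
  proof -
    define l where "l = (\<bar>J (- T e)\<bar> + 1) / J e"
    have l: "l * J e = \<bar>J (- T e)\<bar> + 1" "0 \<le> l" using e by (auto simp: l_def)
    then have "0 < J (l *\<^sub>R e - T e)"
      using add[of "l *\<^sub>R e" "- T e"] sc[of l e] by simp
    then have "l \<in> A" unfolding A_def using l e by (auto intro!: exI[of _ e])
    then show ?thesis by blast
  qed
  have r0: "0 \<le> r"
    unfolding r_def using ne by (intro cInf_greatest) (auto simp: A_def)
  have no: "J (T u - r *\<^sub>R u) \<le> 0" for u
  proof (rule ccontr)
    assume contra: "\<not> ?thesis"
    \<comment> \<open>After the sign change \<open>w\<close> looks like a witness for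
      \<open>r\<close>, except that \<open>0 \<le> J w\<close> is missing. The goal is to show
      \<open>0 < J w\<close>, after which \<open>r\<close> can be lowered.\<close>
    define w where "w = - u"
    have w: "0 < J (r *\<^sub>R w - T w)"
      using contra by (simp add: w_def linear_neg[OF T])
    obtain \<epsilon> where eps: "\<epsilon> > 0" "\<And>s. \<bar>s\<bar> \<le> \<epsilon> \<Longrightarrow> 0 < J ((r *\<^sub>R w - T w) + s *\<^sub>R w)"
      using superlinear_line_cont[OF J w] by blast
    have "\<exists>l\<in>A. l < r + \<epsilon>"
      using cInf_lessD[OF ne, of "r + \<epsilon>"] eps by (auto simp: r_def)
    then obtain l0 v where l0: "0 \<le> l0" "l0 < r + \<epsilon>" and v: "0 \<le> J v" "0 < J (l0 *\<^sub>R v - T v)"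
      by (auto simp: A_def)
    \<comment> \<open>A level at which \<open>v\<close> and \<open>w\<close> both satisfy the strict
      inequality: \<open>v\<close> because \<open>l0 < l\<close>, \<open>w\<close> by the choice of
      \<open>\<epsilon>\<close>.\<close>
    define l where "l = r + \<epsilon>"
    have l: "0 < l" using r0 eps by (simp add: l_def)
    have lv: "0 < J (l *\<^sub>R v - T v)"
    proof -
      have eq: "l *\<^sub>R v - T v = (l0 *\<^sub>R v - T v) + (l - l0) *\<^sub>R v" by (simp add: algebra_simps)
      have "J (l0 *\<^sub>R v - T v) + J ((l - l0) *\<^sub>R v) \<le> J (l *\<^sub>R v - T v)"
        unfolding eq by (rule add)
      moreover have "0 \<le> J ((l - l0) *\<^sub>R v)" using sc[of "l - l0" v] v l0 by (simp add: l_def)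
      ultimately show ?thesis using v by linarith
    qed
    have lw: "0 < J (l *\<^sub>R w - T w)"
    proof -
      have eq: "l *\<^sub>R w - T w = (r *\<^sub>R w - T w) + \<epsilon> *\<^sub>R w" by (simp add: l_def algebra_simps)
      show ?thesis unfolding eq using eps by simp
    qed
    \<comment> \<open>Invariance upgrades \<open>0 \<le> J z\<close> to a strict inequality:
      \<open>l * J z\<close> is at least \<open>J (l *\<^sub>R z - T z) + J (T z)\<close>.\<close>
    have pos: "0 < J z" if z: "0 \<le> J z" "0 < J (l *\<^sub>R z - T z)" for z
    proof -
      have "J (l *\<^sub>R z - T z) + J (T z) \<le> J (l *\<^sub>R z)"
        using add[of "l *\<^sub>R z - T z" "T z"] by simp
      then have "0 < l * J z" using sc[of l z] l inv[OF z(1)] z(2) by simp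
      then show ?thesis using l by (simp add: zero_less_mult_iff)
    qed
    have Jv: "0 < J v" by (rule pos[OF v(1) lv])
    \<comment> \<open>Let \<open>t0\<close> be the least \<open>t \<ge> 0\<close> with \<open>J (w + t v) \<ge> 0\<close>. By \<open>pos\<close> the inequality is strict at \<open>t0\<close>,
      so \<open>t0\<close> could be decreased unless it is \<open>0\<close>; hence \<open>J w > 0\<close>.\<close>
    define S where "S = {t. 0 \<le> t \<and> 0 \<le> J (w + t *\<^sub>R v)}"
    have Sne: "S \<noteq> {}"
    proof -
      define t where "t = \<bar>J w\<bar> / J v"
      have "0 \<le> t" "t * J v = \<bar>J w\<bar>" using Jv by (auto simp: t_def)
      then have "t \<in> S" unfolding S_def using add[of w "t *\<^sub>R v"] sc[of t v] by simp
      then show ?thesis by blast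
    qed
    have Sbdd: "bdd_below S" by (intro bdd_belowI[of _ 0]) (simp add: S_def)
    define t0 where "t0 = Inf S"
    have t0: "0 \<le> t0" unfolding t0_def using Sne by (intro cInf_greatest) (auto simp: S_def)
    have "0 \<le> J (w + t0 *\<^sub>R v)"
    proof (rule ccontr)
      assume neg: "\<not> 0 \<le> J (w + t0 *\<^sub>R v)"
      \<comment> \<open>Going back to \<open>t0\<close> from a point of \<open>S\<close> less than
        \<open>h\<close> above it costs less than \<open>- J (w + t0 *\<^sub>R v)\<close>, which
        contradicts \<open>neg\<close>.\<close>
      define h where "h = - J (w + t0 *\<^sub>R v) / (\<bar>J (- v)\<bar> + 1)"
      have h: "h > 0" using neg by (simp add: h_def divide_neg_pos)
      obtain t where t: "t \<in> S" "t < t0 + h"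
        using cInf_lessD[OF Sne, of "t0 + h"] h by (auto simp: t0_def)
      have tt: "t0 \<le> t" unfolding t0_def by (rule cInf_lower[OF t(1) Sbdd])
      have eq: "w + t0 *\<^sub>R v = (w + t *\<^sub>R v) + (t - t0) *\<^sub>R (- v)" by (simp add: algebra_simps)
      have "J (w + t *\<^sub>R v) + J ((t - t0) *\<^sub>R (- v)) \<le> J (w + t0 *\<^sub>R v)"
        by (subst eq, rule add)
      then have "(t - t0) * J (- v) \<le> J (w + t0 *\<^sub>R v)"
        using sc[of "t - t0" "- v"] tt t(1) by (simp add: S_def)
      moreover have "(t - t0) * J (- v) \<ge> (t - t0) * (- (\<bar>J (- v)\<bar> + 1))"
        using tt by (intro mult_left_mono) auto
      moreover have "(t - t0) * (\<bar>J (- v)\<bar> + 1) < h * (\<bar>J (- v)\<bar> + 1)"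
        using t by (intro mult_strict_right_mono) auto
      moreover have "h * (\<bar>J (- v)\<bar> + 1) = - J (w + t0 *\<^sub>R v)"
        unfolding h_def by (simp add: add_nonneg_eq_0_iff)
      ultimately show False by simp
    qed
    moreover have "0 < J (l *\<^sub>R (w + t0 *\<^sub>R v) - T (w + t0 *\<^sub>R v))"
    proof -
      have eq: "l *\<^sub>R (w + t0 *\<^sub>R v) - T (w + t0 *\<^sub>R v) = (l *\<^sub>R w - T w) + t0 *\<^sub>R (l *\<^sub>R v - T v)"
        by (simp add: linear_add[OF T] linear_scale[OF T] algebra_simps)
      have "0 \<le> J (t0 *\<^sub>R (l *\<^sub>R v - T v))" using sc[OF t0, of "l *\<^sub>R v - T v"] lv t0 by simp
      then show ?thesis
        using lw add[of "l *\<^sub>R w - T w" "t0 *\<^sub>R (l *\<^sub>R v - T v)"] unfolding eq by linarith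
    qed
    ultimately have wt: "0 < J (w + t0 *\<^sub>R v)" by (rule pos)
    have "t0 = 0"
    proof (rule ccontr)
      assume "t0 \<noteq> 0"
      obtain \<delta> where del: "\<delta> > 0" "\<And>s. \<bar>s\<bar> \<le> \<delta> \<Longrightarrow> 0 < J ((w + t0 *\<^sub>R v) + s *\<^sub>R v)"
        using superlinear_line_cont[OF J wt] by blast
      define s where "s = min \<delta> t0"
      have s: "0 < s" "s \<le> \<delta>" "s \<le> t0" using del t0 \<open>t0 \<noteq> 0\<close> by (auto simp: s_def)
      have "0 < J ((w + t0 *\<^sub>R v) + (- s) *\<^sub>R v)" using del(2)[of "- s"] s by simp
      also have "(w + t0 *\<^sub>R v) + (- s) *\<^sub>R v = w + (t0 - s) *\<^sub>R v" by (simp add: algebra_simps)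
      finally have "t0 - s \<in> S" using s by (simp add: S_def)
      then have "t0 \<le> t0 - s" unfolding t0_def by (intro cInf_lower Sbdd)
      then show False using s by simp
    qed
    with wt have Jw: "0 < J w" by simp
    \<comment> \<open>Members of \<open>A\<close> are nonnegative, so \<open>r = 0\<close> cannot be
      lowered; there \<open>0 < J (- T w)\<close> contradicts \<open>0 \<le> J (T w)\<close>
      directly.\<close>
    show False
    proof (cases "r = 0")
      case True
      then show False
        using w inv[of w] Jw superlinear_uminus[OF J, of "T w"] by simp
    next
      case False
      define s where "s = min \<epsilon> r"
      have s: "0 < s" "s \<le> \<epsilon>" "s \<le> r" using eps r0 False by (auto simp: s_def)
      have "0 < J ((r *\<^sub>R w - T w) + (- s) *\<^sub>R w)" using eps(2)[of "- s"] s by simp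
      also have "(r *\<^sub>R w - T w) + (- s) *\<^sub>R w = (r - s) *\<^sub>R w - T w" by (simp add: algebra_simps)
      finally have "r - s \<in> A" using s Jw by (auto simp: A_def intro!: exI[of _ w])
      then have "r \<le> r - s" unfolding r_def by (intro cInf_lower bdd)
      then show False using s by simp
    qed
  qed
  have "linear (\<lambda>u. T u - r *\<^sub>R u)"
    by (intro linear_compose_sub T linear_scaleR)
  then have "subspace (range (\<lambda>u. T u - r *\<^sub>R u))"
    using linear_subspace_image subspace_UNIV by blast
  then obtain p where p: "linear p" "\<And>x. J x \<le> p x" "\<And>m. m \<in> range (\<lambda>u. T u - r *\<^sub>R u) \<Longrightarrow> p m = 0"
    using no by (rule_tac Hahn_Banach_annihilator[OF J]) auto
  have "p (T x) = r * p x" for x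
    using p(3)[of "T x - r *\<^sub>R x"] by (simp add: linear_diff[OF p(1)] linear_scale[OF p(1)])
  then show ?thesis using that p by blast
qed

section \<open>Finitely and countably additive probabilities on the natural numbers\<close>

lemma linf_iff: "x \<in> linf \<longleftrightarrow> (\<exists>B. \<forall>n. \<bar>x n\<bar> \<le> B)"
  by (auto simp: linf_def bounded_iff)

lemma linfI: "(\<And>n. \<bar>x n\<bar> \<le> B) \<Longrightarrow> x \<in> linf"
  by (auto simp: linf_iff)

lemma abs_le_supn: "x \<in> linf \<Longrightarrow> \<bar>x n\<bar> \<le> supn x"
  unfolding supn_def by (rule cSUP_upper) (auto simp: linf_iff intro: bdd_aboveI2)

lemma supn_nonneg: "x \<in> linf \<Longrightarrow> 0 \<le> supn x"
  using abs_le_supn[of x 0] by linarith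

lemma linf_const [simp, intro]: "(\<lambda>_. a) \<in> linf"
  by (rule linfI[where B = "\<bar>a\<bar>"]) simp

lemma linf_add [simp, intro]: "x \<in> linf \<Longrightarrow> y \<in> linf \<Longrightarrow> (\<lambda>n. x n + y n) \<in> linf"
  by (rule linfI[where B = "supn x + supn y"]) (intro order_trans[OF abs_triangle_ineq] add_mono abs_le_supn)

lemma linf_scale [simp, intro]: "x \<in> linf \<Longrightarrow> (\<lambda>n. a * x n) \<in> linf"
  by (rule linfI[where B = "\<bar>a\<bar> * supn x"]) (simp add: abs_mult abs_le_supn mult_left_mono)

lemma linf_diff [simp, intro]: "x \<in> linf \<Longrightarrow> y \<in> linf \<Longrightarrow> (\<lambda>n. x n - y n) \<in> linf"
  using linf_add[of x "\<lambda>n. (- 1) * y n"] linf_scale[of y "- 1"] by simp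

lemma linf_splice [simp, intro]: "x \<in> linf \<Longrightarrow> y \<in> linf \<Longrightarrow> (\<lambda>n. if P n then x n else y n) \<in> linf"
  by (rule linfI[where B = "supn x + supn y"])
    (auto simp: supn_nonneg intro: add_increasing add_increasing2 abs_le_supn)

text \<open>The elements of \<Delta> as normalized positive functionals; the value \<open>0\<close>
  off \<open>linf\<close> follows the convention of \<open>ba\<close>.\<close>

definition mean :: "((nat \<Rightarrow> real) \<Rightarrow> real) \<Rightarrow> bool" where
  "mean \<phi> \<longleftrightarrow> (\<forall>x\<in>linf. \<forall>y\<in>linf. \<phi> (\<lambda>n. x n + y n) = \<phi> x + \<phi> y)
     \<and> (\<forall>a. \<forall>x\<in>linf. \<phi> (\<lambda>n. a * x n) = a * \<phi> x)
     \<and> (\<forall>x\<in>linf. (\<forall>n. 0 \<le> x n) \<longrightarrow> 0 \<le> \<phi> x)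
     \<and> \<phi> (\<lambda>_. 1) = 1 \<and> (\<forall>x. x \<notin> linf \<longrightarrow> \<phi> x = 0)"

text \<open>For means, tightness is countable additivity.\<close>

definition tight :: "((nat \<Rightarrow> real) \<Rightarrow> real) \<Rightarrow> bool" where
  "tight \<phi> \<longleftrightarrow> (\<lambda>N. \<phi> (\<lambda>i. if i < N then 0 else 1)) \<longlonglongrightarrow> 0"

lemma mean_add: "mean \<phi> \<Longrightarrow> x \<in> linf \<Longrightarrow> y \<in> linf \<Longrightarrow> \<phi> (\<lambda>n. x n + y n) = \<phi> x + \<phi> y"
  and mean_scale: "mean \<phi> \<Longrightarrow> x \<in> linf \<Longrightarrow> \<phi> (\<lambda>n. a * x n) = a * \<phi> x"
  and mean_nonneg: "mean \<phi> \<Longrightarrow> x \<in> linf \<Longrightarrow> (\<And>n. 0 \<le> x n) \<Longrightarrow> 0 \<le> \<phi> x"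
  and mean_one: "mean \<phi> \<Longrightarrow> \<phi> (\<lambda>_. 1) = 1"
  by (auto simp: mean_def)

lemma mean_const: "mean \<phi> \<Longrightarrow> \<phi> (\<lambda>_. a) = a"
  using mean_scale[of \<phi> "\<lambda>_. 1" a] mean_one[of \<phi>] by simp

lemma mean_diff: "mean \<phi> \<Longrightarrow> x \<in> linf \<Longrightarrow> y \<in> linf \<Longrightarrow> \<phi> (\<lambda>n. x n - y n) = \<phi> x - \<phi> y"
  using mean_add[of \<phi> "\<lambda>n. x n - y n" y] by simp

lemma mean_mono: "mean \<phi> \<Longrightarrow> x \<in> linf \<Longrightarrow> y \<in> linf \<Longrightarrow> (\<And>n. y n \<le> x n) \<Longrightarrow> \<phi> y \<le> \<phi> x"
  using mean_nonneg[of \<phi> "\<lambda>n. x n - y n"] mean_diff[of \<phi> x y] by simp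

text \<open>The dominating \<open>y\<close> will be \<open>1\<close> for the norm bound and an
  indicator for estimates on tails and small sets.\<close>

lemma mean_abs_le_scaled:
  assumes \<phi>: "mean \<phi>" and "x \<in> linf" "y \<in> linf" and le: "\<And>n. \<bar>x n\<bar> \<le> B * y n"
  shows "\<bar>\<phi> x\<bar> \<le> B * \<phi> y"
proof -
  have "\<phi> x \<le> \<phi> (\<lambda>n. B * y n)" "\<phi> (\<lambda>n. (- B) * y n) \<le> \<phi> x"
    using le linf_scale[OF assms(3), of "- B"]
    by (auto intro!: mean_mono[OF \<phi>] assms linf_scale simp: abs_le_iff minus_le_iff)
  moreover have "\<phi> (\<lambda>n. B * y n) = B * \<phi> y" "\<phi> (\<lambda>n. (- B) * y n) = - B * \<phi> y"
    using assms mean_scale by blast+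
  ultimately show ?thesis by (simp add: abs_le_iff)
qed

lemma mean_abs_le:
  assumes \<phi>: "mean \<phi>" "x \<in> linf"
  shows "\<bar>\<phi> x\<bar> \<le> supn x"
  using mean_abs_le_scaled[OF assms linf_const, of "supn x" 1] assms
  by (simp add: abs_le_supn mean_const)

lemma mean_imp_ba: "mean \<phi> \<Longrightarrow> \<phi> \<in> ba"
  unfolding ba_def using mean_abs_le[of \<phi>]
  by (auto simp: mean_def intro!: exI[of _ 1])

lemma mean_truncate:
  assumes \<phi>: "mean \<phi>" and x: "x \<in> linf"
  shows "\<phi> x - (\<Sum>n<N. \<phi> (\<lambda>i. if i = n then 1 else 0) * x n) = \<phi> (\<lambda>i. if i < N then 0 else x i)"
proof (induction N)
  case (Suc N)
  have l: "(\<lambda>i. if i < k then 0 else x i) \<in> linf" for k using x by (intro linf_splice) auto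
  have e: "(\<lambda>i. x N * (if i = N then 1 else 0)) \<in> linf" by (intro linf_scale linf_splice) auto
  have eq: "(\<lambda>i. if i < N then 0 else x i) = (\<lambda>i. (if i < Suc N then 0 else x i) + x N * (if i = N then 1 else 0))"
    by (auto simp: fun_eq_iff less_Suc_eq)
  have "\<phi> (\<lambda>i. if i < N then 0 else x i)
      = \<phi> (\<lambda>i. if i < Suc N then 0 else x i) + x N * \<phi> (\<lambda>i. if i = N then 1 else 0)"
    unfolding eq by (subst mean_add[OF \<phi> l e], subst mean_scale[OF \<phi>]) (auto intro!: linf_splice)
  then show ?case using Suc by (simp add: mult.commute)
qed simp

section \<open>Countable additivity as tightness\<close>

lemma embed_summable:
  assumes "p \<in> DeltaSigma" "x \<in> linf"
  shows "summable (\<lambda>n. p n * x n)"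
proof (rule summable_comparison_test')
  show "summable (\<lambda>n. p n * supn x)"
    using assms by (intro summable_mult2) (auto simp: DeltaSigma_def)
  show "norm (p n * x n) \<le> p n * supn x" if "n \<ge> 0" for n
    using assms abs_le_supn[OF assms(2), of n]
    by (simp add: DeltaSigma_def abs_mult mult_left_mono)
qed

lemma embed_mean:
  assumes p: "p \<in> DeltaSigma"
  shows "mean (embed p)"
proof -
  have "pair (\<lambda>n. x n + y n) p = pair x p + pair y p" if "x \<in> linf" "y \<in> linf" for x y
    unfolding pair_def using suminf_add[OF embed_summable[OF p that(1)] embed_summable[OF p that(2)]]
    by (simp add: algebra_simps)
  moreover have "pair (\<lambda>n. a * x n) p = a * pair x p" if "x \<in> linf" for a x
    unfolding pair_def using suminf_mult[OF embed_summable[OF p that], of a]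
    by (simp add: algebra_simps)
  moreover have "0 \<le> pair x p" if "x \<in> linf" "\<forall>n. 0 \<le> x n" for x
    unfolding pair_def using embed_summable[OF p that(1)] that p
    by (intro suminf_nonneg) (auto simp: DeltaSigma_def)
  moreover have "pair (\<lambda>_. 1) p = 1"
    using p by (simp add: pair_def DeltaSigma_def)
  ultimately show ?thesis by (simp add: mean_def embed_def)
qed

text \<open>The mass of the tail from \<open>N\<close> on is \<open>1\<close> minus the partial sum
  of \<open>p\<close>.\<close>

lemma embed_tight:
  assumes p: "p \<in> DeltaSigma"
  shows "tight (embed p)"
proof -
  have "embed p (\<lambda>i. if i < N then 0 else 1) = 1 - (\<Sum>n<N. p n)" for N
  proof -
    have "embed p (\<lambda>i. if i = n then 1 else 0) = p n" for n
    proof -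
      have "(\<lambda>k. p k * (if k = n then 1 else 0)) sums p n"
        using sums_single[of n p] by (simp add: if_distrib eq_commute cong: if_cong)
      moreover have "(\<lambda>i. if i = n then 1 else 0 :: real) \<in> linf" by (intro linf_splice) auto
      ultimately show ?thesis by (simp add: embed_def pair_def sums_iff)
    qed
    then show ?thesis
      using mean_truncate[OF embed_mean[OF p] linf_const, of 1 N] mean_one[OF embed_mean[OF p]]
      by simp
  qed
  moreover have "(\<lambda>N. 1 - (\<Sum>n<N. p n)) \<longlonglongrightarrow> 1 - 1"
    using p summable_sums[of p] by (intro tendsto_diff tendsto_const) (auto simp: DeltaSigma_def sums_def)
  ultimately show ?thesis by (simp add: tight_def)
qed

text \<open>The candidate sequence consists of the masses of singletons. What its partial sums miss
  of \<open>\<phi> x\<close> is the mean of the tail of \<open>x\<close>, at most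
  \<open>supn x\<close> times a vanishing tail mass.\<close>

lemma tight_mean_imp_embed:
  assumes \<phi>: "mean \<phi>" and t: "tight \<phi>"
  shows "\<phi> \<in> embed ` DeltaSigma"
proof -
  define p where "p = (\<lambda>n. \<phi> (\<lambda>i. if i = n then 1 else 0))"
  have sums: "(\<lambda>n. p n * x n) sums \<phi> x" if x: "x \<in> linf" for x
  proof -
    have "(\<lambda>N. \<phi> x - (\<Sum>n<N. p n * x n)) \<longlonglongrightarrow> 0"
    proof (rule Lim_null_comparison)
      show "\<forall>\<^sub>F N in sequentially. norm (\<phi> x - (\<Sum>n<N. p n * x n)) \<le> supn x * \<phi> (\<lambda>i. if i < N then 0 else 1)"
      proof (rule always_eventually, rule allI)
        fix N
        have "\<bar>\<phi> (\<lambda>i. if i < N then 0 else x i)\<bar> \<le> supn x * \<phi> (\<lambda>i. if i < N then 0 else 1)"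
          using x by (intro mean_abs_le_scaled[OF \<phi>]) (auto simp: abs_le_supn)
        then show "norm (\<phi> x - (\<Sum>n<N. p n * x n)) \<le> supn x * \<phi> (\<lambda>i. if i < N then 0 else 1)"
          using mean_truncate[OF \<phi> x, of N] by (simp add: p_def)
      qed
      show "(\<lambda>N. supn x * \<phi> (\<lambda>i. if i < N then 0 else 1)) \<longlonglongrightarrow> 0"
        using tendsto_mult_right_zero t unfolding tight_def by blast
    qed
    then show ?thesis
      unfolding sums_def by (rule Lim_transform2[OF tendsto_const])
  qed
  have "0 \<le> p n" for n
    unfolding p_def by (rule mean_nonneg[OF \<phi>]) (auto intro!: linf_splice)
  moreover have "p sums 1"
    using sums[OF linf_const[of 1]] mean_one[OF \<phi>] by simp
  ultimately have "p \<in> DeltaSigma" by (simp add: DeltaSigma_def sums_iff)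
  moreover have "\<phi> = embed p"
    using sums \<phi> by (auto simp: fun_eq_iff embed_def pair_def sums_iff mean_def)
  ultimately show ?thesis by blast
qed

text \<open>Outside a tail of small mass there are finitely many points, and each of them eventually
  leaves the sets \<open>E n\<close>.\<close>

lemma tight_mean_decreasing_sets:
  assumes \<phi>: "mean \<phi>" and t: "tight \<phi>"
    and E: "\<And>n. E (Suc n) \<subseteq> E n" "(\<Inter>n. E n) = {}" and \<epsilon>: "\<epsilon> > 0"
  shows "\<exists>n. \<phi> (\<lambda>i. if i \<in> E n then 1 else 0) < \<epsilon>"
proof -
  from t \<epsilon> have "\<forall>\<^sub>F N in sequentially. \<phi> (\<lambda>i. if i < N then 0 else 1) < \<epsilon>"
    unfolding tight_def by (rule order_tendstoD(2))
  then obtain N where N: "\<phi> (\<lambda>i. if i < N then 0 else 1) < \<epsilon>"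
    using eventually_sequentially by auto
  have dec: "E n \<subseteq> E m" if "m \<le> n" for m n
    using lift_Suc_antimono_le[of E, OF E(1) that] .
  have "\<exists>n. i \<notin> E n" for i using E(2) by blast
  then obtain k where k: "\<And>i. i \<notin> E (k i)" by metis
  \<comment> \<open>The inserted \<open>0\<close> keeps \<open>Max\<close> meaningful when
    \<open>N = 0\<close>.\<close>
  define n where "n = Max (insert 0 (k ` {..<N}))"
  have "i \<notin> E n" if "i < N" for i
    using k[of i] dec[of "k i" n] that by (auto simp: n_def)
  then have "\<phi> (\<lambda>i. if i \<in> E n then 1 else 0) \<le> \<phi> (\<lambda>i. if i < N then 0 else 1)"
    by (intro mean_mono[OF \<phi>] linf_splice) auto
  with N show ?thesis by (auto intro!: exI[of _ n])
qed

section \<open>Eigenvectors of the adjoint and weak* compactness\<close>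

lemma T_linf: "cont_pos_linear T \<Longrightarrow> x \<in> linf \<Longrightarrow> T x \<in> linf"
  and T_add: "cont_pos_linear T \<Longrightarrow> x \<in> linf \<Longrightarrow> y \<in> linf \<Longrightarrow> T (\<lambda>n. x n + y n) = (\<lambda>n. T x n + T y n)"
  and T_scale: "cont_pos_linear T \<Longrightarrow> x \<in> linf \<Longrightarrow> T (\<lambda>n. a * x n) = (\<lambda>n. a * T x n)"
  and T_nonneg: "cont_pos_linear T \<Longrightarrow> x \<in> linf \<Longrightarrow> (\<And>n. 0 \<le> x n) \<Longrightarrow> 0 \<le> T x n"
  by (auto simp: cont_pos_linear_def)

text \<open>Since \<open>\<phi>\<close> maps \<open>1\<close> to \<open>1\<close>, the eigenvalue
  can only be \<open>\<phi> (T (\<lambda>_. 1))\<close>. Writing it out avoids an existential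
  quantifier and leaves a condition that is visibly closed.\<close>

definition eigenmean :: "((nat \<Rightarrow> real) \<Rightarrow> (nat \<Rightarrow> real)) \<Rightarrow> ((nat \<Rightarrow> real) \<Rightarrow> real) \<Rightarrow> bool" where
  "eigenmean T \<phi> \<longleftrightarrow> mean \<phi> \<and> (\<forall>x\<in>linf. \<phi> (T x) = \<phi> (T (\<lambda>_. 1)) * \<phi> x)"

text \<open>Evaluating the eigenvector equation at \<open>1\<close> identifies the eigenvalue, and
  tightness recovers the sequence \<open>p\<close>.\<close>

lemma Fset_iff: "\<phi> \<in> Fset T \<longleftrightarrow> eigenmean T \<phi> \<and> tight \<phi>"
proof
  assume "\<phi> \<in> Fset T"
  then obtain p r where p: "p \<in> DeltaSigma" "\<phi> = embed p" and r: "adjoint T \<phi> = (\<lambda>x. r * \<phi> x)"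
    by (auto simp: Fset_def eigenvector_def)
  have m: "mean \<phi>" "tight \<phi>" using embed_mean embed_tight p by auto
  have "\<phi> (T x) = r * \<phi> x" if "x \<in> linf" for x
    using fun_cong[OF r, of x] that by (simp add: adjoint_def)
  then show "eigenmean T \<phi> \<and> tight \<phi>"
    using m mean_one[OF m(1)] by (simp add: eigenmean_def)
next
  assume *: "eigenmean T \<phi> \<and> tight \<phi>"
  then have m: "mean \<phi>" by (simp add: eigenmean_def)
  obtain p where p: "p \<in> DeltaSigma" "\<phi> = embed p"
    using tight_mean_imp_embed[OF m] * by blast
  have "eigenvector T \<phi>"
    unfolding eigenvector_def
  proof (intro conjI exI)
    show "\<phi> \<in> ba" by (rule mean_imp_ba[OF m])
    show "\<phi> \<noteq> (\<lambda>_. 0)" using mean_one[OF m] by auto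
    show "adjoint T \<phi> = (\<lambda>x. \<phi> (T (\<lambda>_. 1)) * \<phi> x)"
    proof
      fix x
      show "adjoint T \<phi> x = \<phi> (T (\<lambda>_. 1)) * \<phi> x"
      proof (cases "x \<in> linf")
        case True
        then have "\<phi> (T x) = \<phi> (T (\<lambda>_. 1)) * \<phi> x" using * unfolding eigenmean_def by blast
        then show ?thesis unfolding adjoint_def if_P[OF True] .
      qed (use m in \<open>simp add: adjoint_def mean_def\<close>)
    qed
  qed
  with p show "\<phi> \<in> Fset T" by (auto simp: Fset_def)
qed

text \<open>Each condition compares continuous expressions in finitely many coordinates of
  \<open>\<phi>\<close>. Hence only tightness can be lost in passing from \<open>Fset T\<close> to
  \<open>Fbar T\<close>.\<close>

lemma closed_eigenmeans: "closed {\<phi>. eigenmean T \<phi>}"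
proof -
  have coord: "continuous_on UNIV (\<lambda>\<phi>::(nat \<Rightarrow> real) \<Rightarrow> real. \<phi> x)" for x
    by simp
  note ci = continuous_intros coord
  show ?thesis
    unfolding eigenmean_def mean_def Ball_def
    by (intro closed_Collect_conj closed_Collect_all closed_Collect_imp open_Collect_const
        closed_Collect_eq closed_Collect_le ci)
qed

lemma Fbar_eigenmean: "\<phi> \<in> Fbar T \<Longrightarrow> eigenmean T \<phi>"
  using closure_minimal[OF _ closed_eigenmeans, of "Fset T" T] Fset_iff[of _ T]
  unfolding Fbar_def by blast

lemma Fset_subset_Fbar: "Fset T \<subseteq> Fbar T"
  unfolding Fbar_def by (rule closure_subset)

text \<open>The Banach-Alaoglu argument: means lie in a product of compact intervals, which is
  compact by Tychonoff's theorem.\<close>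

lemma compact_Fbar: "compact (Fbar T)"
proof -
  \<comment> \<open>The absolute value makes each interval contain \<open>0\<close> also for
    unbounded \<open>x\<close>, where \<open>supn x\<close> carries no information.\<close>
  define B where "B = (\<lambda>x::nat \<Rightarrow> real. {- \<bar>supn x\<bar>..\<bar>supn x\<bar>})"
  have "compact (PiE UNIV B)"
    using compactin_PiE[of "\<lambda>_. euclidean" UNIV B]
    by (simp add: euclidean_product_topology B_def)
  moreover have "Fbar T \<subseteq> PiE UNIV B"
  proof
    fix \<phi> assume "\<phi> \<in> Fbar T"
    then have m: "mean \<phi>" using Fbar_eigenmean eigenmean_def by blast
    have "\<bar>\<phi> x\<bar> \<le> \<bar>supn x\<bar>" for x
      using mean_abs_le[OF m, of x] m by (cases "x \<in> linf") (auto simp: mean_def)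
    then show "\<phi> \<in> PiE UNIV B" by (auto simp: B_def abs_le_iff minus_le_iff)
  qed
  ultimately show ?thesis
    using compact_Int_closed[of "PiE UNIV B" "Fbar T"] by (simp add: Fbar_def Int_absorb1)
qed

section \<open>Invariant supergradients\<close>

text \<open>The directional derivative of \<open>g\<close> at \<open>0\<close> is superlinear, lies
  above \<open>g\<close>, is finite by \<open>bound\<close> and inherits the invariance under
  \<open>T\<close>, so it has an eigenfunctional above it.\<close>

lemma concave_invariant_supergradient:
  fixes g :: "'a::real_vector \<Rightarrow> real"
  assumes conc: "\<And>s a b. 0 \<le> s \<Longrightarrow> s \<le> 1 \<Longrightarrow> s * g a + (1 - s) * g b \<le> g (s *\<^sub>R a + (1 - s) *\<^sub>R b)"
    and g0: "g 0 = 0"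
    and bound: "\<And>d. \<exists>K. \<forall>t>0. g (t *\<^sub>R d) \<le> t * K"
    and e: "0 < g e" and T: "linear T"
    and inv: "\<And>d. 0 \<le> g d \<Longrightarrow> 0 \<le> g (T d)"
  obtains p r where "linear p" "\<And>d. g d \<le> p d" "\<And>d. p (T d) = r * p d"
proof -
  \<comment> \<open>the directional derivative of \<open>g\<close> at \<open>0\<close>\<close>
  define J where "J = (\<lambda>d. SUP t\<in>{0<..}. g (t *\<^sub>R d) / t)"
  have bdd: "bdd_above ((\<lambda>t. g (t *\<^sub>R d) / t) ` {0<..})" for d
  proof -
    obtain K where "\<forall>t>0. g (t *\<^sub>R d) \<le> t * K" using bound by blast
    then show ?thesis by (intro bdd_aboveI2[where M = K]) (auto simp: field_simps)
  qed
  have upper: "g (t *\<^sub>R d) / t \<le> J d" if "0 < t" for t d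
    unfolding J_def using that by (intro cSUP_upper bdd) auto
  have least: "J d \<le> z" if "\<And>t. 0 < t \<Longrightarrow> g (t *\<^sub>R d) / t \<le> z" for d z
    unfolding J_def using that by (intro cSUP_least) auto
  have gJ: "g d \<le> J d" for d using upper[of 1 d] by simp
  have decr: "g (s *\<^sub>R d) / s \<le> g (t *\<^sub>R d) / t" if "0 < t" "t \<le> s" for s t d
    using conc[of "t / s" "s *\<^sub>R d" 0] that g0 by (simp add: field_simps)
  have add: "J a + J b \<le> J (a + b)" for a b
  proof -
    have "J a \<le> J (a + b) - J b"
    proof (rule least)
      fix s :: real assume s: "0 < s"
      have "J b \<le> J (a + b) - g (s *\<^sub>R a) / s"
      proof (rule least)
        fix t :: real assume t: "0 < t"
        \<comment> \<open>Difference quotients grow as the step shrinks, so both can be moved to the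
          common step \<open>m\<close>; midpoint concavity then gives a quotient of
          \<open>a + b\<close> with step \<open>m / 2\<close>.\<close>
        define m where "m = min s t"
        have m: "0 < m" using s t by (simp add: m_def)
        have "g (s *\<^sub>R a) / s + g (t *\<^sub>R b) / t \<le> g (m *\<^sub>R a) / m + g (m *\<^sub>R b) / m"
          using s t by (intro add_mono decr) (auto simp: m_def)
        also have "\<dots> = (1/2 * g (m *\<^sub>R a) + (1 - 1/2) * g (m *\<^sub>R b)) / (m / 2)"
          using m by (simp add: field_simps)
        also have "\<dots> \<le> g ((1/2) *\<^sub>R (m *\<^sub>R a) + (1 - 1/2) *\<^sub>R (m *\<^sub>R b)) / (m / 2)"
          using m by (intro divide_right_mono conc) auto
        also have "\<dots> = g ((m / 2) *\<^sub>R (a + b)) / (m / 2)"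
          by (simp add: scaleR_add_right)
        also have "\<dots> \<le> J (a + b)" using m by (intro upper) auto
        finally show "g (t *\<^sub>R b) / t \<le> J (a + b) - g (s *\<^sub>R a) / s" by simp
      qed
      then show "g (s *\<^sub>R a) / s \<le> J (a + b) - J b" by simp
    qed
    then show ?thesis by simp
  qed
  have half: "t * J d \<le> J (t *\<^sub>R d)" if t: "0 < t" for t d
  proof -
    have "J d \<le> J (t *\<^sub>R d) / t"
    proof (rule least)
      fix s :: real assume s: "0 < s"
      then show "g (s *\<^sub>R d) / s \<le> J (t *\<^sub>R d) / t"
        using upper[of "s / t" "t *\<^sub>R d"] t by (simp add: field_simps)
    qed
    then show ?thesis using t by (simp add: field_simps)
  qed
  have J: "superlinear J" by (rule superlinearI[OF add half])
  note sc = superlinear_scale[OF J]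
  have Je: "0 < J e" using gJ[of e] e by linarith
  have "0 \<le> J (T d)" if d: "0 \<le> J d" for d
  proof (rule ccontr)
    assume neg: "\<not> 0 \<le> J (T d)"
    \<comment> \<open>If \<open>J d = 0\<close>, all quotients of \<open>g\<close> along
      \<open>d\<close> may be negative, and \<open>inv\<close> does not apply. Adding
      \<open>\<epsilon> *\<^sub>R e\<close> makes \<open>J\<close> positive, hence some quotient;
      letting \<epsilon> shrink then contradicts \<open>neg\<close>.\<close>
    have "\<epsilon> * J (- T e) \<le> J (T d)" if eps: "\<epsilon> > 0" for \<epsilon>
    proof -
      have "0 < J (d + \<epsilon> *\<^sub>R e)"
        using add[of d "\<epsilon> *\<^sub>R e"] sc[of \<epsilon> e] d mult_pos_pos[OF eps Je] eps by simp
      then obtain t where t: "0 < t" "0 < g (t *\<^sub>R (d + \<epsilon> *\<^sub>R e)) / t"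
        using least[of "d + \<epsilon> *\<^sub>R e" 0] by (meson not_less)
      then have "0 \<le> g (T (t *\<^sub>R (d + \<epsilon> *\<^sub>R e)))"
        by (intro inv) (simp add: zero_less_divide_iff)
      then have "0 \<le> J (t *\<^sub>R T (d + \<epsilon> *\<^sub>R e))"
        using gJ[of "t *\<^sub>R T (d + \<epsilon> *\<^sub>R e)"] linear_scale[OF T, of t "d + \<epsilon> *\<^sub>R e"] by simp
      then have "0 \<le> J (T (d + \<epsilon> *\<^sub>R e))"
        using sc[of t "T (d + \<epsilon> *\<^sub>R e)"] t by (simp add: zero_le_mult_iff)
      moreover have "T (d + \<epsilon> *\<^sub>R e) + \<epsilon> *\<^sub>R (- T e) = T d"
        by (simp add: linear_add[OF T] linear_scale[OF T])
      then have "J (T (d + \<epsilon> *\<^sub>R e)) + J (\<epsilon> *\<^sub>R (- T e)) \<le> J (T d)"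
        using add[of "T (d + \<epsilon> *\<^sub>R e)" "\<epsilon> *\<^sub>R (- T e)"] by simp
      moreover have "J (\<epsilon> *\<^sub>R (- T e)) = \<epsilon> * J (- T e)" using eps by (intro sc) simp
      ultimately show ?thesis by simp
    qed
    note lim = this
    define \<epsilon> where "\<epsilon> = - J (T d) / (2 * (\<bar>J (- T e)\<bar> + 1))"
    have eps: "\<epsilon> > 0" "\<epsilon> * (\<bar>J (- T e)\<bar> + 1) = - J (T d) / 2"
      using neg by (auto simp: \<epsilon>_def divide_neg_pos add_nonneg_eq_0_iff field_simps)
    have "\<epsilon> * (- (\<bar>J (- T e)\<bar> + 1)) \<le> \<epsilon> * J (- T e)"
      using eps by (intro mult_left_mono) auto
    then have "- (\<epsilon> * (\<bar>J (- T e)\<bar> + 1)) \<le> J (T d)"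
      using lim[OF eps(1)] by (simp only: mult_minus_right)
    then show False using eps(2) neg by linarith
  qed
  then obtain p r where "linear p" "\<And>x. J x \<le> p x" "\<And>x. p (T x) = r * p x"
    using superlinear_positive_eigenfunctional[OF J Je T] by blast
  then show ?thesis using that gJ order_trans by metis
qed

text \<open>In the language of risk measures, \<open>- I\<close> is a convex risk measure, up to
  normalization.\<close>

definition concave_niveloid :: "((nat \<Rightarrow> real) \<Rightarrow> real) \<Rightarrow> bool" where
  "concave_niveloid I \<longleftrightarrow>
     (\<forall>x\<in>linf. \<forall>y\<in>linf. (\<forall>n. y n \<le> x n) \<longrightarrow> I y \<le> I x)
   \<and> (\<forall>x\<in>linf. \<forall>\<theta>. I (\<lambda>n. x n + \<theta>) = I x + \<theta>)
   \<and> (\<forall>x\<in>linf. \<forall>y\<in>linf. \<forall>t\<in>{0..1}. t * I x + (1 - t) * I y \<le> I (\<lambda>n. t * x n + (1 - t) * y n))"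

lemma niveloid_mono: "concave_niveloid I \<Longrightarrow> x \<in> linf \<Longrightarrow> y \<in> linf \<Longrightarrow> (\<And>n. y n \<le> x n) \<Longrightarrow> I y \<le> I x"
  and niveloid_translate: "concave_niveloid I \<Longrightarrow> x \<in> linf \<Longrightarrow> I (\<lambda>n. x n + \<theta>) = I x + \<theta>"
  and niveloid_concave: "concave_niveloid I \<Longrightarrow> x \<in> linf \<Longrightarrow> y \<in> linf \<Longrightarrow> 0 \<le> t \<Longrightarrow> t \<le> 1 \<Longrightarrow>
      t * I x + (1 - t) * I y \<le> I (\<lambda>n. t * x n + (1 - t) * y n)"
  by (auto simp: concave_niveloid_def)

lemma niveloid_le_add:
  assumes I: "concave_niveloid I" "x \<in> linf" "y \<in> linf" and le: "\<And>n. y n \<le> x n + B"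
  shows "I y \<le> I x + B"
  using niveloid_mono[OF I(1), of "\<lambda>n. x n + B" y] niveloid_translate[OF I(1,2), of B] assms by simp

text \<open>Every sequence is continuous on the discrete space of naturals. This makes a vector
  space type available for the abstract results.\<close>

lemma linf_eq_bcontfun: "x \<in> linf \<longleftrightarrow> x \<in> bcontfun"
  by (simp add: linf_def bcontfun_def)

text \<open>The abstract supergradient is applied to the increment
  \<open>g d = I (x + d) - I x\<close>. Monotonicity of \<open>I\<close> makes the functional
  positive, translation invariance normalizes it.\<close>

lemma niveloid_invariant_supergradient:
  assumes T: "cont_pos_linear T" and I: "concave_niveloid I"
    and inv: "\<And>x d. x \<in> linf \<Longrightarrow> d \<in> linf \<Longrightarrow> I x \<le> I (\<lambda>n. x n + d n) \<Longrightarrow> I x \<le> I (\<lambda>n. x n + T d n)"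
    and x: "x \<in> linf"
  obtains \<phi> where "eigenmean T \<phi>" "\<And>y. y \<in> linf \<Longrightarrow> I y - \<phi> y \<le> I x - \<phi> x"
proof -
  define g where "g = (\<lambda>d :: nat \<Rightarrow>\<^sub>C real. I (\<lambda>n. x n + apply_bcontfun d n) - I x)"
  define L where "L = (\<lambda>d :: nat \<Rightarrow>\<^sub>C real. Bcontfun (T (apply_bcontfun d)))"
  have ap [simp, intro]: "apply_bcontfun d \<in> linf" for d
    by (simp add: linf_eq_bcontfun apply_bcontfun)
  have Bi: "apply_bcontfun (Bcontfun y) = y" if "y \<in> linf" for y
    using that by (simp add: linf_eq_bcontfun Bcontfun_inverse)
  have xd [simp, intro]: "(\<lambda>n. x n + apply_bcontfun d n) \<in> linf" for d
    using x by (intro linf_add) auto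
  have Lap: "apply_bcontfun (L d) = T (apply_bcontfun d)" for d
    unfolding L_def using T_linf[OF T] by (intro Bi) auto
  have lin: "linear L"
  proof (rule linearI)
    show "L (a + b) = L a + L b" for a b
      by (rule bcontfun_eqI) (use T_add[OF T ap ap, of a b] in \<open>simp add: Lap plus_bcontfun.rep_eq\<close>)
    show "L (c *\<^sub>R b) = c *\<^sub>R L b" for c b
      by (rule bcontfun_eqI) (use T_scale[OF T ap, of c b] in \<open>simp add: Lap scaleR_bcontfun.rep_eq\<close>)
  qed
  obtain p r where p: "linear p" "\<And>d. g d \<le> p d" "\<And>d. p (L d) = r * p d"
  proof (rule concave_invariant_supergradient[of g "const_bcontfun 1" L])
    fix s :: real and a b assume s: "0 \<le> s" "s \<le> 1"
    have "(\<lambda>n. x n + apply_bcontfun (s *\<^sub>R a + (1 - s) *\<^sub>R b) n)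
        = (\<lambda>n. s * (x n + apply_bcontfun a n) + (1 - s) * (x n + apply_bcontfun b n))"
      by (simp add: fun_eq_iff algebra_simps plus_bcontfun.rep_eq scaleR_bcontfun.rep_eq)
    then show "s * g a + (1 - s) * g b \<le> g (s *\<^sub>R a + (1 - s) *\<^sub>R b)"
      unfolding g_def using niveloid_concave[OF I xd xd s, of a b] by (simp add: algebra_simps)
  next
    show "g 0 = 0" by (simp add: g_def)
    show "\<exists>K. \<forall>t>0. g (t *\<^sub>R d) \<le> t * K" for d
    proof (intro exI allI impI)
      fix t :: real assume t: "t > 0"
      have "apply_bcontfun d n \<le> norm d" for n
        using norm_bounded[of d n] by simp
      then show "g (t *\<^sub>R d) \<le> t * norm d"
        unfolding g_def using niveloid_le_add[OF I x xd, of "t *\<^sub>R d" "t * norm d"] t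
        by (simp add: scaleR_bcontfun.rep_eq)
    qed
    show "0 < g (const_bcontfun 1)"
      using niveloid_translate[OF I x, of 1] by (simp add: g_def const_bcontfun.rep_eq)
    show "0 \<le> g (L d)" if "0 \<le> g d" for d
      using inv[OF x ap, of d] that by (simp add: g_def Lap)
  qed (use lin in auto)
  define \<phi> where "\<phi> = (\<lambda>y. if y \<in> linf then p (Bcontfun y) else 0)"
  have gI: "I (\<lambda>n. x n + y n) - I x \<le> \<phi> y" if y: "y \<in> linf" for y
    using p(2)[of "Bcontfun y"] y Bi[OF y] by (simp add: g_def \<phi>_def)
  have add: "\<phi> (\<lambda>n. y n + z n) = \<phi> y + \<phi> z" if "y \<in> linf" "z \<in> linf" for y z
  proof -
    have "Bcontfun (\<lambda>n. y n + z n) = Bcontfun y + Bcontfun z"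
      using that by (intro bcontfun_eqI) (simp add: Bi plus_bcontfun.rep_eq)
    then show ?thesis using that by (simp add: \<phi>_def linear_add[OF p(1)])
  qed
  have scale: "\<phi> (\<lambda>n. a * y n) = a * \<phi> y" if "y \<in> linf" for a y
  proof -
    have "Bcontfun (\<lambda>n. a * y n) = a *\<^sub>R Bcontfun y"
      using that by (intro bcontfun_eqI) (simp add: Bi scaleR_bcontfun.rep_eq)
    then show ?thesis using that by (simp add: \<phi>_def linear_scale[OF p(1)])
  qed
  have pos: "0 \<le> \<phi> y" if "y \<in> linf" "\<And>n. 0 \<le> y n" for y
    using gI[OF that(1)] niveloid_mono[OF I, of "\<lambda>n. x n + y n" x] x that by simp
  \<comment> \<open>Translations by \<open>1\<close> and by \<open>- 1\<close> give
    \<open>\<phi> 1 \<ge> 1\<close> and \<open>\<phi> 1 \<le> 1\<close>.\<close>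
  have one: "\<phi> (\<lambda>_. 1) = 1"
    using gI[OF linf_const[of 1]] gI[OF linf_const[of "- 1"]] scale[OF linf_const[of 1], of "- 1"]
      niveloid_translate[OF I x, of 1] niveloid_translate[OF I x, of "- 1"] by simp
  have m: "mean \<phi>" using add scale pos one by (simp add: mean_def \<phi>_def)
  have "\<phi> (T y) = r * \<phi> y" if y: "y \<in> linf" for y
    using p(3)[of "Bcontfun y"] y T_linf[OF T y] by (simp add: \<phi>_def L_def Bi)
  then have "eigenmean T \<phi>" using m one by (simp add: eigenmean_def)
  moreover have "I y - \<phi> y \<le> I x - \<phi> x" if y: "y \<in> linf" for y
    using gI[OF linf_diff[OF y x]] mean_diff[OF m y x] by simp
  ultimately show ?thesis using that by blast
qed

text \<open>If a loss \<open>K\<close> on some tail still leaves a positive value of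
  \<open>I\<close>, then \<open>K + 1\<close> times the mass of that tail is less than
  \<open>1 + C\<close>; and \<open>K\<close> is arbitrary.\<close>

lemma finite_conjugate_imp_tight:
  assumes \<phi>: "mean \<phi>" and C: "\<And>y. y \<in> linf \<Longrightarrow> I y \<le> \<phi> y + C"
    and mc: "\<And>K::real. \<exists>N::nat. 0 < I (\<lambda>i. if i < N then 1 else - K)"
  shows "tight \<phi>"
  unfolding tight_def
proof (rule LIMSEQ_I)
  fix \<epsilon> :: real assume eps: "0 < \<epsilon>"
  let ?t = "\<lambda>N. \<phi> (\<lambda>i. if i < N then 0 else 1)"
  have tl: "(\<lambda>i. if i < N then 0 else 1::real) \<in> linf" for N :: nat by (intro linf_splice) auto
  define K where "K = (1 + \<bar>C\<bar>) / \<epsilon>"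
  obtain N where N: "0 < I (\<lambda>i. if i < N then 1 else - K)" using mc by blast
  have eq: "(\<lambda>i. if i < N then 1 else - K) = (\<lambda>i. 1 - (K + 1) * (if i < N then 0 else 1))"
    by (simp add: fun_eq_iff)
  have "\<phi> (\<lambda>i. 1 - (K + 1) * (if i < N then 0 else 1)) = 1 - (K + 1) * ?t N"
    using mean_diff[OF \<phi> linf_const linf_scale[OF tl]] mean_scale[OF \<phi> tl] mean_one[OF \<phi>] by simp
  moreover have "I (\<lambda>i. if i < N then 1 else - K) \<le> \<phi> (\<lambda>i. if i < N then 1 else - K) + C"
    by (intro C linf_splice) auto
  ultimately have "(K + 1) * ?t N < 1 + C" using N unfolding eq by linarith
  then have lt: "(K + 1) * ?t N < 1 + \<bar>C\<bar>" by linarith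
  have nn: "0 \<le> ?t k" for k by (rule mean_nonneg[OF \<phi> tl]) simp
  have tN: "?t N < \<epsilon>"
  proof (rule ccontr)
    assume "\<not> ?t N < \<epsilon>"
    then have "K * \<epsilon> \<le> K * ?t N" unfolding K_def using eps by (intro mult_left_mono) auto
    moreover have "K * \<epsilon> = 1 + \<bar>C\<bar>" using eps by (simp add: K_def)
    ultimately show False using lt nn[of N] by (simp add: algebra_simps)
  qed
  have "norm (?t k - 0) < \<epsilon>" if "k \<ge> N" for k
  proof -
    have "?t k \<le> ?t N" using that by (intro mean_mono[OF \<phi> tl tl]) auto
    with tN nn[of k] show ?thesis by simp
  qed
  then show "\<exists>no. \<forall>n\<ge>no. norm (?t n - 0) < \<epsilon>" by blast
qed

text \<open>An invariant supergradient at \<open>x\<close> attains the supremum defining its cost,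
  hence the minimum at \<open>x\<close>. Sublevel sets of \<open>c\<close> are closed because
  \<open>c\<close> is a supremum of weak* continuous functions.\<close>

lemma niveloid_representation:
  assumes T: "cont_pos_linear T" and I: "concave_niveloid I" and I0: "I (\<lambda>_. 0) = 0"
    and inv: "\<And>x d. x \<in> linf \<Longrightarrow> d \<in> linf \<Longrightarrow> I x \<le> I (\<lambda>n. x n + d n) \<Longrightarrow> I x \<le> I (\<lambda>n. x n + T d n)"
    and mc: "\<And>K::real. \<exists>N::nat. 0 < I (\<lambda>i. if i < N then 1 else - K)"
  shows "\<exists>c. cost_ok T c \<and> min_rep T c I"
proof (intro exI conjI)
  define c where "c = (\<lambda>\<phi>. SUP x\<in>linf. ereal (I x - \<phi> x))"
  have lower: "ereal (I x - \<phi> x) \<le> c \<phi>" if "x \<in> linf" for x \<phi>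
    unfolding c_def using that by (rule SUP_upper)
  have tight: "tight \<phi>" if \<phi>: "mean \<phi>" and C: "c \<phi> \<le> ereal C" for \<phi> C
  proof (rule finite_conjugate_imp_tight[OF \<phi> _ mc])
    fix y assume "y \<in> linf"
    then have "ereal (I y - \<phi> y) \<le> ereal C" using lower C order_trans by blast
    then show "I y \<le> \<phi> y + C" by simp
  qed
  have minimizer: "\<exists>\<phi>\<in>Fset T. c \<phi> = ereal (I x - \<phi> x)" if x: "x \<in> linf" for x
  proof -
    obtain \<phi> where \<phi>: "eigenmean T \<phi>" "\<And>y. y \<in> linf \<Longrightarrow> I y - \<phi> y \<le> I x - \<phi> x"
      using niveloid_invariant_supergradient[OF T I inv x] by blast
    have le: "c \<phi> \<le> ereal (I x - \<phi> x)"
      unfolding c_def using \<phi>(2) by (intro SUP_least) simp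
    then have "tight \<phi>" using \<phi>(1) tight unfolding eigenmean_def by blast
    with \<phi>(1) have "\<phi> \<in> Fset T" by (simp add: Fset_iff)
    then show ?thesis using le lower[OF x, of \<phi>] by (intro bexI antisym)
  qed
  have nonneg: "0 \<le> c \<phi>" if "\<phi> \<in> Fbar T" for \<phi>
    using lower[OF linf_const[of 0], of \<phi>] I0 mean_const[of \<phi> 0] Fbar_eigenmean[OF that]
    by (simp add: eigenmean_def zero_ereal_def)
  show "cost_ok T c"
    unfolding cost_ok_def
  proof (intro conjI ballI allI)
    show "(INF \<phi>\<in>Fbar T. c \<phi>) = 0"
    proof (rule antisym)
      \<comment> \<open>The minimizer at the zero sequence has cost zero, which gives
        groundedness.\<close>
      obtain \<phi> where \<phi>: "\<phi> \<in> Fset T" "c \<phi> = ereal (I (\<lambda>_. 0) - \<phi> (\<lambda>_. 0))"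
        using minimizer[OF linf_const] by blast
      then have "c \<phi> = 0"
        using I0 mean_const[of \<phi> 0] by (simp add: Fset_iff eigenmean_def)
      then show "(INF \<phi>\<in>Fbar T. c \<phi>) \<le> 0"
        using \<phi>(1) Fset_subset_Fbar by (metis INF_lower subsetD)
    qed (use nonneg in \<open>auto intro: INF_greatest\<close>)
    fix t :: real
    have "{\<phi> \<in> Fbar T. c \<phi> \<le> ereal t} = Fbar T \<inter> (\<Inter>x\<in>linf. {\<phi>. I x - \<phi> x \<le> t})"
      unfolding c_def by (auto simp: SUP_le_iff)
    moreover have "closed {\<phi>::(nat \<Rightarrow> real) \<Rightarrow> real. I x - \<phi> x \<le> t}" for x
      by (intro closed_Collect_le continuous_intros) simp
    ultimately show "closed {\<phi> \<in> Fbar T. c \<phi> \<le> ereal t}"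
      unfolding Fbar_def by (metis (no_types, lifting) closed_Int closed_INT closed_closure)
  next
    fix \<phi> assume \<phi>: "\<phi> \<in> Fbar T - Fset T"
    then have e: "eigenmean T \<phi>" using Fbar_eigenmean by blast
    show "c \<phi> = \<infinity>"
    proof (cases "c \<phi>")
      case (real C)
      then have "tight \<phi>" using e tight[of \<phi> C] by (simp add: eigenmean_def)
      then show ?thesis using \<phi> e by (simp add: Fset_iff)
    next
      case MInf
      then show ?thesis using nonneg[of \<phi>] \<phi> by simp
    qed
  qed (use nonneg in auto)
  show "min_rep T c I"
    unfolding min_rep_def
  proof (rule ballI)
    fix x assume x: "x \<in> linf"
    obtain \<phi> where \<phi>: "\<phi> \<in> Fset T" "c \<phi> = ereal (I x - \<phi> x)" using minimizer[OF x] by blast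
    have F: "\<phi> \<in> Fbar T" using \<phi>(1) Fset_subset_Fbar by blast
    have eq: "ereal (\<phi> x) + c \<phi> = ereal (I x)" using \<phi>(2) by simp
    have "ereal (I x) \<le> ereal (\<psi> x) + c \<psi>" for \<psi>
    proof -
      have "ereal (\<psi> x) + ereal (I x - \<psi> x) \<le> ereal (\<psi> x) + c \<psi>"
        using lower[OF x] by (intro add_left_mono)
      then show ?thesis by simp
    qed
    then have "ereal (I x) = (INF \<phi>\<in>Fbar T. ereal (\<phi> x) + c \<phi>)"
      using F eq by (intro antisym INF_greatest INF_lower2[OF F]) auto
    then show "ereal (I x) = (INF \<phi>\<in>Fbar T. ereal (\<phi> x) + c \<phi>) \<and>
        (\<exists>\<phi>\<in>Fbar T. ereal (\<phi> x) + c \<phi> = ereal (I x))"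
      using F eq by blast
  qed
qed

section \<open>From the axioms to the representation\<close>

text \<open>If \<open>a < b\<close>, ICRP repeats the preference in steps of \<open>b - a\<close>;
  by transitivity \<open>0\<close> is weakly preferred to a constant above \<open>1\<close>, against
  \<open>1\<close> being strictly better than \<open>0\<close>.\<close>

lemma constants_order:
  assumes R: "weak_order R" "monotonicity R" "icrp R" and c: "R (\<lambda>_. a) (\<lambda>_. b)"
  shows "b \<le> a"
proof (rule ccontr)
  assume "\<not> b \<le> a"
  define d where "d = b - a"
  have d: "d > 0" using \<open>\<not> b \<le> a\<close> by (simp add: d_def)
  have tr: "R x z" if "R x y" "R y z" "x \<in> linf" "y \<in> linf" "z \<in> linf" for x y z
    using that R(1) unfolding weak_order_def by blast
  have shift: "R (\<lambda>_. s) (\<lambda>_. s + d)" for s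
  proof -
    have "R (\<lambda>_. a + (s - a)) (\<lambda>_. b + (s - a))"
      using R(3) c linf_const[of a] linf_const[of b] unfolding icrp_def by blast
    then show ?thesis by (simp add: d_def algebra_simps)
  qed
  have step: "R (\<lambda>_. 0) (\<lambda>_. real n * d)" for n
  proof (induction n)
    case 0
    show ?case using R(1) unfolding weak_order_def by auto
  next
    case (Suc n)
    have "R (\<lambda>_. real n * d) (\<lambda>_. real (Suc n) * d)"
      using shift[of "real n * d"] by (simp add: algebra_simps)
    with Suc show ?case by (rule tr) auto
  qed
  obtain n :: nat where n: "1 < real n * d" using reals_Archimedean3[OF d] by blast
  then have "R (\<lambda>_. real n * d) (\<lambda>_. 1)" using R(2) unfolding monotonicity_def by auto
  then have "R (\<lambda>_. 0) (\<lambda>_. 1)" using tr[OF step] by blast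
  then show False using R(2) by (simp add: monotonicity_def strict_def)
qed

text \<open>The constants between \<open>- B\<close> and \<open>B\<close> that are weakly better and
  weakly worse than \<open>x\<close> form two nonempty closed sets covering an interval; by
  connectedness they meet.\<close>

lemma constant_equivalent_exists:
  assumes R: "weak_order R" "monotonicity R" "continuity R" and x: "x \<in> linf"
  shows "\<exists>\<theta>. R x (\<lambda>_. \<theta>) \<and> R (\<lambda>_. \<theta>) x"
proof -
  define B where "B = supn x"
  have "R (\<lambda>_. B) x" "R x (\<lambda>_. - B)"
    using R(2) x abs_le_supn[OF x] unfolding monotonicity_def B_def by (auto simp: abs_le_iff minus_le_iff)
  define f where "f = (\<lambda>\<alpha>::real. \<alpha> * B + (1 - \<alpha>) * (- B))"
  define U where "U = {\<alpha>\<in>{0..1}. R (\<lambda>_. f \<alpha>) x}"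
  define V where "V = {\<alpha>\<in>{0..1}. R x (\<lambda>_. f \<alpha>)}"
  have cl: "closed U" "closed V"
    using R(3) \<open>R (\<lambda>_. B) x\<close> \<open>R x (\<lambda>_. - B)\<close> x unfolding continuity_def U_def V_def f_def by blast+
  have cov: "{0..1} \<subseteq> U \<union> V"
    using R(1) x unfolding weak_order_def U_def V_def by blast
  have "1 \<in> U" "0 \<in> V" using \<open>R (\<lambda>_. B) x\<close> \<open>R x (\<lambda>_. - B)\<close> by (auto simp: U_def V_def f_def)
  then have "U \<inter> V \<inter> {0..1} \<noteq> {}"
    using connected_closedD[OF connected_Icc[of 0 1] _ cov cl] by fastforce
  then show ?thesis by (auto simp: U_def V_def)
qed

lemma axioms_imp_niveloid:
  assumes A: "all_axioms T R"
  obtains I where "concave_niveloid I" "const_equiv R I" "\<And>\<theta>. I (\<lambda>_. \<theta>) = \<theta>"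
proof -
  from A have R: "weak_order R" "monotonicity R" "continuity R" "icrp R" "convexity R"
    by (auto simp: all_axioms_def)
  note le = constants_order[OF R(1,2,4)]
  have tr: "R x z" if "R x y" "R y z" "x \<in> linf" "y \<in> linf" "z \<in> linf" for x y z
    using that R(1) unfolding weak_order_def by blast
  have mono: "R x y" if "x \<in> linf" "y \<in> linf" "\<And>n. y n \<le> x n" for x y
    using that R(2) unfolding monotonicity_def by blast
  have icrp: "R (\<lambda>n. x n + \<theta>) (\<lambda>n. y n + \<theta>)" if "R x y" "x \<in> linf" "y \<in> linf" for x y \<theta>
    using that R(4) unfolding icrp_def by blast
  obtain I where I: "\<And>x. x \<in> linf \<Longrightarrow> R x (\<lambda>_. I x) \<and> R (\<lambda>_. I x) x"
    using constant_equivalent_exists[OF R(1,2,3)] by metis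
  have iff: "R x y \<longleftrightarrow> I y \<le> I x" if "x \<in> linf" "y \<in> linf" for x y
  proof
    assume "R x y"
    then have "R (\<lambda>_. I x) (\<lambda>_. I y)"
      using tr[of "\<lambda>_. I x" x y] tr[of "\<lambda>_. I x" y "\<lambda>_. I y"] I that by blast
    then show "I y \<le> I x" by (rule le)
  next
    assume "I y \<le> I x"
    then have "R (\<lambda>_. I x) (\<lambda>_. I y)" by (intro mono) auto
    then show "R x y"
      using tr[of x "\<lambda>_. I x" "\<lambda>_. I y"] tr[of x "\<lambda>_. I y" y] I that by blast
  qed
  have const: "I (\<lambda>_. \<theta>) = \<theta>" for \<theta>
    using I[OF linf_const[of \<theta>]] le[of \<theta> "I (\<lambda>_. \<theta>)"] le[of "I (\<lambda>_. \<theta>)" \<theta>] by (intro antisym) auto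
  have trans: "I (\<lambda>n. x n + \<theta>) = I x + \<theta>" if x: "x \<in> linf" for x \<theta>
  proof -
    have l: "(\<lambda>n. x n + \<theta>) \<in> linf" using x by auto
    have "R (\<lambda>n. x n + \<theta>) (\<lambda>_. I x + \<theta>)" "R (\<lambda>_. I x + \<theta>) (\<lambda>n. x n + \<theta>)"
      using icrp[of x "\<lambda>_. I x" \<theta>] icrp[of "\<lambda>_. I x" x \<theta>] I[OF x] x by auto
    then show ?thesis
      using iff[OF l linf_const] iff[OF linf_const l] by (simp add: const)
  qed
  have conc: "t * I x + (1 - t) * I y \<le> I (\<lambda>n. t * x n + (1 - t) * y n)"
    if x: "x \<in> linf" and y: "y \<in> linf" and t: "t \<in> {0..1}" for x y t
  proof -
    \<comment> \<open>Both acts are translated to indifference with \<open>0\<close>, where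
      Convexity applies with a common constant.\<close>
    let ?x = "\<lambda>n. x n + - I x" and ?y = "\<lambda>n. y n + - I y"
    let ?m = "t * I x + (1 - t) * I y"
    let ?z = "\<lambda>n. t * x n + (1 - t) * y n"
    have l: "?x \<in> linf" "?y \<in> linf" using linf_add[OF x linf_const] linf_add[OF y linf_const] by blast+
    have z: "?z \<in> linf" using x y by (intro linf_add linf_scale)
    have "I ?x = 0" "I ?y = 0" using trans[OF x, of "- I x"] trans[OF y, of "- I y"] by simp_all
    then have "R ?x (\<lambda>_. 0)" "R ?y (\<lambda>_. 0)" using iff[OF l(1) linf_const] iff[OF l(2) linf_const] const by simp_all
    then have "R (\<lambda>n. t * ?x n + (1 - t) * ?y n) (\<lambda>_. 0)"
      using R(5) l t unfolding convexity_def by blast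
    moreover have "(\<lambda>n. t * ?x n + (1 - t) * ?y n) = (\<lambda>n. ?z n + - ?m)"
      by (simp add: fun_eq_iff algebra_simps)
    ultimately have "R (\<lambda>n. ?z n + - ?m) (\<lambda>_. 0)" by (simp only:)
    then have "I (\<lambda>_. 0) \<le> I (\<lambda>n. ?z n + - ?m)"
      by (rule iffD1[OF iff[OF linf_add[OF z linf_const] linf_const]])
    then show ?thesis unfolding trans[OF z] const by linarith
  qed
  have "concave_niveloid I"
    unfolding concave_niveloid_def
  proof (intro conjI ballI allI impI)
    show "I y \<le> I x" if "x \<in> linf" "y \<in> linf" "\<forall>n. y n \<le> x n" for x y
      using iff mono that by blast
  qed (use trans conc in auto)
  moreover have "const_equiv R I" using I iff by (simp add: const_equiv_def)
  ultimately show ?thesis using that const by blast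
qed

lemma axioms_imp_representation:
  assumes T: "cont_pos_linear T" and A: "all_axioms T R"
  shows "\<exists>c I. cost_ok T c \<and> min_rep T c I \<and> const_equiv R I
           \<and> (\<forall>J. const_equiv R J \<longrightarrow> (\<forall>x\<in>linf. J x = I x))"
proof -
  obtain I where I: "concave_niveloid I" and ce: "const_equiv R I" and const: "\<And>\<theta>. I (\<lambda>_. \<theta>) = \<theta>"
    using axioms_imp_niveloid[OF A] by blast
  have iff: "R x y \<longleftrightarrow> I y \<le> I x" if "x \<in> linf" "y \<in> linf" for x y
    using ce that by (simp add: const_equiv_def)
  have "\<exists>c. cost_ok T c \<and> min_rep T c I"
  proof (rule niveloid_representation[OF T I])
    show "I (\<lambda>_. 0) = 0" by (rule const)
    show "I x \<le> I (\<lambda>n. x n + T d n)" if "x \<in> linf" "d \<in> linf" "I x \<le> I (\<lambda>n. x n + d n)" for x d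
      using A that T_linf[OF T that(2)] iff linf_add unfolding all_axioms_def ITIS_def by blast
  next
    fix K :: real
    \<comment> \<open>Monotone continuity for the constant act \<open>1\<close> and the tails
      \<open>{n..}\<close>, which decrease to the empty set.\<close>
    have mc: "strict R (\<lambda>_. 1) (\<lambda>_. 0) \<and> (\<forall>n. {Suc n..} \<subseteq> {n..}) \<and> (\<Inter>n. {n..}) = ({}::nat set) \<longrightarrow>
      (\<exists>n0. strict R (\<lambda>i. if i \<in> {n0..} then - K else 1) (\<lambda>_. 0))"
      using A linf_const[of 1] unfolding all_axioms_def monotone_continuity_def by blast
    have "strict R (\<lambda>_. 1) (\<lambda>_. 0)" using A by (simp add: all_axioms_def monotonicity_def)
    moreover have "(\<Inter>n. {n..}) = ({}::nat set)"
    proof -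
      have "x \<notin> (\<Inter>n. {n..})" for x :: nat by (auto intro!: exI[of _ "Suc x"])
      then show ?thesis by blast
    qed
    ultimately obtain N where N: "strict R (\<lambda>i. if i \<in> {N..} then - K else 1) (\<lambda>_. 0)"
      using mc by auto
    have eq: "(\<lambda>i. if i \<in> {N..} then - K else 1) = (\<lambda>i. if i < N then 1 else - K)" by auto
    have l: "(\<lambda>i. if i < N then 1 else - K) \<in> linf" by (intro linf_splice) auto
    have "0 < I (\<lambda>i. if i < N then 1 else - K)"
      using N iff[OF linf_const l, of 0] unfolding eq strict_def by (simp add: const)
    then show "\<exists>N::nat. 0 < I (\<lambda>i. if i < N then 1 else - K)" by blast
  qed
  moreover have "J x = I x" if J: "const_equiv R J" and x: "x \<in> linf" for J x
  proof -
    have "R x (\<lambda>_. J x)" "R (\<lambda>_. J x) x" using J x by (auto simp: const_equiv_def)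
    then show ?thesis using iff[OF x linf_const] iff[OF linf_const x] by (simp add: const)
  qed
  ultimately show ?thesis using ce by blast
qed

section \<open>From the representation to the axioms\<close>

lemma min_rep_upper:
  assumes "min_rep T c I" "x \<in> linf" "\<phi> \<in> Fbar T"
  shows "ereal (I x) \<le> ereal (\<phi> x) + c \<phi>"
proof -
  have "ereal (I x) = (INF \<phi>\<in>Fbar T. ereal (\<phi> x) + c \<phi>)" using assms by (simp add: min_rep_def)
  also have "\<dots> \<le> ereal (\<phi> x) + c \<phi>" by (rule INF_lower2[OF assms(3)]) simp
  finally show ?thesis .
qed

text \<open>A finite minimum forces a finite cost \<open>r\<close>, hence a minimizer in
  \<open>Fset T\<close>. The result is an affine majorant of \<open>I\<close> that is exact at
  \<open>x\<close>, the form used in the converse direction.\<close>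

lemma min_rep_attained:
  assumes c: "cost_ok T c" and I: "min_rep T c I" and x: "x \<in> linf"
  obtains \<phi> r where "\<phi> \<in> Fset T" "mean \<phi>" "I x = \<phi> x + r" "\<And>y. y \<in> linf \<Longrightarrow> I y \<le> \<phi> y + r"
proof -
  obtain \<phi> where \<phi>: "\<phi> \<in> Fbar T" "ereal (\<phi> x) + c \<phi> = ereal (I x)"
    using I x unfolding min_rep_def by blast
  obtain r where r: "c \<phi> = ereal r" using \<phi>(2) by (cases "c \<phi>") auto
  have F: "\<phi> \<in> Fset T" using c \<phi>(1) r unfolding cost_ok_def by force
  have "I y \<le> \<phi> y + r" if "y \<in> linf" for y
    using min_rep_upper[OF I that \<phi>(1)] r by simp
  moreover have "mean \<phi>" using F by (simp add: Fset_iff eigenmean_def)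
  moreover have "I x = \<phi> x + r" using \<phi>(2) r by simp
  ultimately show ?thesis using that F by blast
qed

text \<open>Each lower bound on \<open>I\<close> at a point comes from the affine majorant that is
  exact there, for concavity the one at the mixture.\<close>

lemma representation_niveloid:
  assumes c: "cost_ok T c" and I: "min_rep T c I"
  shows "concave_niveloid I"
  unfolding concave_niveloid_def
proof (intro conjI ballI allI impI)
  fix x y assume xy: "x \<in> linf" "y \<in> linf" "\<forall>n. y n \<le> x n"
  obtain \<phi> r where \<phi>: "mean \<phi>" "I x = \<phi> x + r" "\<And>y. y \<in> linf \<Longrightarrow> I y \<le> \<phi> y + r"
    using min_rep_attained[OF c I xy(1)] by metis
  then show "I y \<le> I x" using \<phi>(3)[OF xy(2)] mean_mono[OF \<phi>(1) xy(1,2)] xy(3) by simp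
next
  fix x and \<theta> :: real assume x: "x \<in> linf"
  have l: "(\<lambda>n. x n + \<theta>) \<in> linf" using x by auto
  have m: "\<phi> (\<lambda>n. x n + \<theta>) = \<phi> x + \<theta>" if "mean \<phi>" for \<phi>
    using mean_add[OF that x linf_const] mean_const[OF that] by simp
  show "I (\<lambda>n. x n + \<theta>) = I x + \<theta>"
  proof (rule antisym)
    obtain \<phi> r where \<phi>: "mean \<phi>" "I x = \<phi> x + r" "\<And>y. y \<in> linf \<Longrightarrow> I y \<le> \<phi> y + r"
      using min_rep_attained[OF c I x] by metis
    then show "I (\<lambda>n. x n + \<theta>) \<le> I x + \<theta>" using \<phi>(3)[OF l] m[OF \<phi>(1)] by simp
  next
    obtain \<phi> r where \<phi>: "mean \<phi>" "I (\<lambda>n. x n + \<theta>) = \<phi> (\<lambda>n. x n + \<theta>) + r" "\<And>y. y \<in> linf \<Longrightarrow> I y \<le> \<phi> y + r"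
      using min_rep_attained[OF c I l] by metis
    then show "I x + \<theta> \<le> I (\<lambda>n. x n + \<theta>)" using \<phi>(3)[OF x] m[OF \<phi>(1)] by simp
  qed
next
  fix x y and t :: real assume xy: "x \<in> linf" "y \<in> linf" and t: "t \<in> {0..1}"
  let ?z = "\<lambda>n. t * x n + (1 - t) * y n"
  have z: "?z \<in> linf" using xy by (intro linf_add linf_scale)
  obtain \<phi> r where \<phi>: "mean \<phi>" "I ?z = \<phi> ?z + r" "\<And>y. y \<in> linf \<Longrightarrow> I y \<le> \<phi> y + r"
    using min_rep_attained[OF c I z] by metis
  have "t * I x + (1 - t) * I y \<le> t * (\<phi> x + r) + (1 - t) * (\<phi> y + r)"
    using \<phi>(3) xy t by (intro add_mono mult_left_mono) auto
  also have "\<dots> = \<phi> ?z + r"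
    using mean_add[OF \<phi>(1) linf_scale[OF xy(1)] linf_scale[OF xy(2)], of t "1 - t"]
      mean_scale[OF \<phi>(1) xy(1), of t] mean_scale[OF \<phi>(1) xy(2), of "1 - t"]
    by (simp add: algebra_simps)
  finally show "t * I x + (1 - t) * I y \<le> I ?z" using \<phi>(2) by simp
qed

text \<open>Along a segment \<open>I\<close> is Lipschitz with constant \<open>supn (x - z)\<close>,
  so the sets in question are cut out by closed conditions.\<close>

lemma niveloid_continuity:
  assumes I: "concave_niveloid I"
  shows "continuity (\<lambda>x y. I y \<le> I x)"
  unfolding continuity_def
proof (intro ballI impI)
  fix x y z assume x: "x \<in> linf" and z: "z \<in> linf"
  define f where "f = (\<lambda>\<alpha>. I (\<lambda>n. \<alpha> * x n + (1 - \<alpha>) * z n))"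
  define B where "B = supn (\<lambda>n. x n - z n)"
  have l: "(\<lambda>n. \<alpha> * x n + (1 - \<alpha>) * z n) \<in> linf" for \<alpha> using x z by (intro linf_add linf_scale)
  have lip: "f \<alpha> \<le> f \<beta> + B * \<bar>\<alpha> - \<beta>\<bar>" for \<alpha> \<beta>
    unfolding f_def
  proof (rule niveloid_le_add[OF I l l])
    fix n
    have "(\<alpha> - \<beta>) * (x n - z n) \<le> \<bar>\<alpha> - \<beta>\<bar> * \<bar>x n - z n\<bar>"
      by (metis abs_ge_self abs_mult)
    also have "\<dots> \<le> \<bar>\<alpha> - \<beta>\<bar> * B"
      unfolding B_def using abs_le_supn[OF linf_diff[OF x z]] by (intro mult_left_mono) auto
    finally show "\<alpha> * x n + (1 - \<alpha>) * z n \<le> \<beta> * x n + (1 - \<beta>) * z n + B * \<bar>\<alpha> - \<beta>\<bar>"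
      by (simp add: algebra_simps)
  qed
  have "B-lipschitz_on UNIV f"
  proof (rule lipschitz_onI)
    show "dist (f \<alpha>) (f \<beta>) \<le> B * dist \<alpha> \<beta>" for \<alpha> \<beta>
      using lip[of \<alpha> \<beta>] lip[of \<beta> \<alpha>] by (simp add: dist_real_def abs_minus_commute abs_le_iff)
    show "0 \<le> B" unfolding B_def by (rule supn_nonneg[OF linf_diff[OF x z]])
  qed
  then have f: "continuous_on UNIV f" by (rule lipschitz_on_continuous_on)
  have "closed ({0..1} \<inter> {\<alpha>. I y \<le> f \<alpha>})" "closed ({0..1} \<inter> {\<alpha>. f \<alpha> \<le> I y})"
    by (intro closed_Int closed_Collect_le f continuous_intros closed_atLeastAtMost)+
  then show "closed {\<alpha>\<in>{0..1}. I y \<le> I (\<lambda>n. \<alpha> * x n + (1 - \<alpha>) * z n)}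
      \<and> closed {\<alpha>\<in>{0..1}. I (\<lambda>n. \<alpha> * x n + (1 - \<alpha>) * z n) \<le> I y}"
    by (simp add: f_def Int_def conj_commute)
qed

text \<open>Closedness is known for sublevel sets of \<open>c\<close> alone. The sum is at most
  \<open>t\<close> exactly when every real \<open>s\<close> satisfies
  \<open>\<phi> x \<le> s\<close> or \<open>c \<phi> \<le> t - s\<close>, an intersection of closed
  sets.\<close>

lemma closed_value_sublevel:
  assumes c: "cost_ok T c"
  shows "closed {\<phi> \<in> Fbar T. ereal (\<phi> x) + c \<phi> \<le> ereal t}"
proof -
  have eq: "{\<phi> \<in> Fbar T. ereal (\<phi> x) + c \<phi> \<le> ereal t}
      = Fbar T \<inter> (\<Inter>s. {\<phi>. \<phi> x \<le> s} \<union> {\<phi> \<in> Fbar T. c \<phi> \<le> ereal (t - s)})" (is "?L = ?R")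
  proof (intro equalityI subsetI)
    fix \<phi> assume \<phi>: "\<phi> \<in> ?L"
    have "\<phi> x \<le> s \<or> c \<phi> \<le> ereal (t - s)" for s
      using \<phi> by (cases "c \<phi>") auto
    then show "\<phi> \<in> ?R" using \<phi> by simp
  next
    fix \<phi> assume \<phi>: "\<phi> \<in> ?R"
    then have "\<forall>s. \<phi> x \<le> s \<or> c \<phi> \<le> ereal (t - s)" by auto
    then have *: "c \<phi> \<le> ereal (t - s)" if "s < \<phi> x" for s using that by (meson not_less)
    have "ereal (\<phi> x) + c \<phi> \<le> ereal t"
    proof (cases "c \<phi>")
      case (real r)
      have "\<phi> x \<le> t - r"
        by (rule dense_le) (use * real in \<open>force simp: algebra_simps\<close>)
      then show ?thesis using real by simp
    qed (use *[of "\<phi> x - 1"] in auto)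
    then show "\<phi> \<in> ?L" using \<phi> by simp
  qed
  have "closed {\<phi>::(nat \<Rightarrow> real) \<Rightarrow> real. \<phi> x \<le> s}" for s
    by (intro closed_Collect_le continuous_intros) simp
  moreover have "closed {\<phi> \<in> Fbar T. c \<phi> \<le> ereal s}" for s
    using c by (simp add: cost_ok_def)
  ultimately show ?thesis
    unfolding eq by (auto simp: Fbar_def intro!: closed_Int closed_INT closed_Un)
qed

lemma representation_monotone_continuity:
  assumes c: "cost_ok T c" and I: "min_rep T c I"
  shows "monotone_continuity (\<lambda>x y. I y \<le> I x)"
  unfolding monotone_continuity_def strict_def
proof (intro ballI allI impI)
  fix x :: "nat \<Rightarrow> real" and \<theta> :: real and E :: "nat \<Rightarrow> nat set" and k :: real
  assume x: "x \<in> linf"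
    and as: "(I (\<lambda>_. \<theta>) \<le> I x \<and> \<not> I x \<le> I (\<lambda>_. \<theta>)) \<and> (\<forall>n. E (Suc n) \<subseteq> E n) \<and> (\<Inter>n. E n) = {}"
  have niv: "concave_niveloid I" by (rule representation_niveloid[OF c I])
  define t where "t = I (\<lambda>_. \<theta>)"
  define B where "B = supn x"
  define m where "m = min k (- B)"
  define y where "y = (\<lambda>n i. if i \<in> E n then m else x i)"
  have B: "\<bar>x i\<bar> \<le> B" for i unfolding B_def by (rule abs_le_supn[OF x])
  have yl: "y n \<in> linf" for n unfolding y_def using x by (intro linf_splice) auto
  have "\<exists>n. t < I (y n)"
  proof (rule ccontr)
    assume "\<not> ?thesis"
    then have low: "I (y n) \<le> t" for n by (simp add: not_less)
    \<comment> \<open>The \<open>S n\<close> are closed, nonempty and decreasing because \<open>y\<close> is increasing (hence \<open>m\<close> instead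
      of \<open>k\<close>); a common point has finite cost, so it is countably additive, and \<open>n \<rightarrow> \<infinity>\<close> gives \<open>I x \<le> t\<close>.\<close>
    define S where "S = (\<lambda>n. {\<phi> \<in> Fbar T. ereal (\<phi> (y n)) + c \<phi> \<le> ereal t})"
    have antimono: "S n \<subseteq> S j" if "j \<le> n" for j n
    proof
      fix \<phi> assume \<phi>: "\<phi> \<in> S n"
      then have m\<phi>: "mean \<phi>" using Fbar_eigenmean by (auto simp: S_def eigenmean_def)
      have "E n \<subseteq> E j" using lift_Suc_antimono_le[of E j n] as that by blast
      then have "\<phi> (y j) \<le> \<phi> (y n)"
        using B by (intro mean_mono[OF m\<phi> yl yl]) (auto simp: y_def m_def abs_le_iff min_le_iff_disj minus_le_iff)
      then have "ereal (\<phi> (y j)) + c \<phi> \<le> ereal (\<phi> (y n)) + c \<phi>" by (intro add_right_mono) simp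
      with \<phi> show "\<phi> \<in> S j" by (auto simp: S_def)
    qed
    have "Fbar T \<inter> (\<Inter>n. S n) \<noteq> {}"
    proof (rule compact_imp_fip_image[OF compact_Fbar])
      show "closed (S n)" for n unfolding S_def by (rule closed_value_sublevel[OF c])
      fix N :: "nat set" assume "finite N"
      define n where "n = Max (insert 0 N)"
      have n: "j \<le> n" if "j \<in> N" for j using that \<open>finite N\<close> by (auto simp: n_def)
      obtain \<phi> where \<phi>: "\<phi> \<in> Fbar T" "ereal (\<phi> (y n)) + c \<phi> = ereal (I (y n))"
        using I yl[of n] unfolding min_rep_def by blast
      then have "\<phi> \<in> S n" using low[of n] by (simp add: S_def)
      then show "Fbar T \<inter> \<Inter> (S ` N) \<noteq> {}" using \<phi>(1) antimono[OF n] by blast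
    qed
    then obtain \<phi> where \<phi>: "\<phi> \<in> Fbar T" "\<And>n. ereal (\<phi> (y n)) + c \<phi> \<le> ereal t" by (auto simp: S_def)
    have "0 \<le> c \<phi>" using c \<phi>(1) by (simp add: cost_ok_def)
    then obtain r where r: "c \<phi> = ereal r" using \<phi>(2)[of 0] by (cases "c \<phi>") auto
    have F: "\<phi> \<in> Fset T" using c \<phi>(1) r unfolding cost_ok_def by force
    then have m\<phi>: "mean \<phi>" and tight: "tight \<phi>" by (auto simp: Fset_iff eigenmean_def)
    have "I x \<le> \<phi> x + r" using min_rep_upper[OF I x \<phi>(1)] r by simp
    \<comment> \<open>Since \<open>x\<close> and \<open>y n\<close> differ only on
      \<open>E n\<close>, by at most \<open>B + \<bar>m\<bar>\<close>, mass below
      \<open>\<epsilon>\<close> gives \<open>I x \<le> \<phi> x + r < \<phi> (y n) + r + (I x - t)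
      \<le> I x\<close>.\<close>
    define \<epsilon> where "\<epsilon> = (I x - t) / (B + \<bar>m\<bar> + 1)"
    have B0: "0 \<le> B" using B[of 0] by linarith
    have eps: "\<epsilon> > 0" using as B0 by (simp add: \<epsilon>_def t_def)
    obtain n where n: "\<phi> (\<lambda>i. if i \<in> E n then 1 else 0) < \<epsilon>"
      using tight_mean_decreasing_sets[OF m\<phi> tight _ _ eps, of E] as by blast
    have el: "(\<lambda>i. if i \<in> E n then 1 else 0::real) \<in> linf" by (intro linf_splice) auto
    have "\<bar>\<phi> (\<lambda>i. x i - y n i)\<bar> \<le> (B + \<bar>m\<bar> + 1) * \<phi> (\<lambda>i. if i \<in> E n then 1 else 0)"
    proof (rule mean_abs_le_scaled[OF m\<phi> linf_diff[OF x yl] el])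
      fix i show "\<bar>x i - y n i\<bar> \<le> (B + \<bar>m\<bar> + 1) * (if i \<in> E n then 1 else 0)"
        using B[of i] by (auto simp: y_def)
    qed
    also have "\<dots> < (B + \<bar>m\<bar> + 1) * \<epsilon>" using n B0 by (intro mult_strict_left_mono) auto
    also have "\<dots> = I x - t" using B0 by (simp add: \<epsilon>_def add_nonneg_eq_0_iff)
    finally have "\<phi> x - \<phi> (y n) < I x - t" using mean_diff[OF m\<phi> x yl] by simp
    moreover have "\<phi> (y n) + r \<le> t" using \<phi>(2)[of n] r by simp
    ultimately show False using \<open>I x \<le> \<phi> x + r\<close> by linarith
  qed
  then obtain n where n: "t < I (y n)" by blast
  \<comment> \<open>Since \<open>m \<le> k\<close>, returning from \<open>m\<close> to
    \<open>k\<close> can only raise the value.\<close>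
  have "I (y n) \<le> I (\<lambda>i. if i \<in> E n then k else x i)"
    using x by (intro niveloid_mono[OF niv] linf_splice yl) (auto simp: y_def m_def)
  then show "\<exists>n0. I (\<lambda>_. \<theta>) \<le> I (\<lambda>i. if i \<in> E n0 then k else x i)
      \<and> \<not> I (\<lambda>i. if i \<in> E n0 then k else x i) \<le> I (\<lambda>_. \<theta>)"
    using n by (auto simp: t_def intro!: exI[of _ n])
qed

lemma representation_ITIS:
  assumes T: "cont_pos_linear T" and c: "cost_ok T c" and I: "min_rep T c I"
    and sub: "\<forall>\<mu>\<in>Fset T. adjoint T \<mu> (\<lambda>_. 1) \<le> 1"
  shows "ITIS T (\<lambda>x y. I y \<le> I x)"
  unfolding ITIS_def
proof (intro ballI impI)
  fix x d assume x: "x \<in> linf" and d: "d \<in> linf" and le: "I x \<le> I (\<lambda>n. x n + d n)"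
  have Td: "T d \<in> linf" by (rule T_linf[OF T d])
  obtain \<phi> r where \<phi>: "\<phi> \<in> Fset T" "mean \<phi>" "I (\<lambda>n. x n + T d n) = \<phi> (\<lambda>n. x n + T d n) + r"
    "\<And>y. y \<in> linf \<Longrightarrow> I y \<le> \<phi> y + r"
    using min_rep_attained[OF c I linf_add[OF x Td]] by metis
  define s where "s = \<phi> (T (\<lambda>_. 1))"
  have s0: "0 \<le> s"
    unfolding s_def using T_linf[OF T linf_const] T_nonneg[OF T linf_const] by (intro mean_nonneg[OF \<phi>(2)]) auto
  have s1: "s \<le> 1" using sub \<phi>(1) by (auto simp: s_def adjoint_def)
  have "\<phi> (T d) = s * \<phi> d" using \<phi>(1) d unfolding Fset_iff eigenmean_def s_def by blast
  \<comment> \<open>The two brackets are the majorant at \<open>x\<close> and at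
    \<open>x + d\<close>, both at least \<open>I x\<close>; the weights are nonnegative by
    positivity of \<open>T\<close> and by \<open>sub\<close>.\<close>
  then have "I (\<lambda>n. x n + T d n) = (1 - s) * (\<phi> x + r) + s * (\<phi> x + \<phi> d + r)"
    using \<phi>(3) mean_add[OF \<phi>(2) x Td] by (simp add: algebra_simps)
  moreover have "(1 - s) * I x \<le> (1 - s) * (\<phi> x + r)"
    using \<phi>(4)[OF x] s1 by (intro mult_left_mono) auto
  moreover have "s * I x \<le> s * (\<phi> x + \<phi> d + r)"
    using le \<phi>(4)[OF linf_add[OF x d]] mean_add[OF \<phi>(2) x d] s0 by (intro mult_left_mono) auto
  ultimately show "I x \<le> I (\<lambda>n. x n + T d n)" by (simp add: algebra_simps)
qed

lemma representation_imp_axioms: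
  assumes T: "cont_pos_linear T" and c: "cost_ok T c" and I: "min_rep T c I"
    and sub: "\<forall>\<mu>\<in>Fset T. adjoint T \<mu> (\<lambda>_. 1) \<le> 1"
  shows "all_axioms T (\<lambda>x y. I y \<le> I x)"
proof -
  have niv: "concave_niveloid I" by (rule representation_niveloid[OF c I])
  have "weak_order (\<lambda>x y. I y \<le> I x)" by (auto simp: weak_order_def)
  moreover have "monotonicity (\<lambda>x y. I y \<le> I x)"
    using niveloid_mono[OF niv] niveloid_translate[OF niv linf_const, of 0 1]
    by (auto simp: monotonicity_def strict_def)
  moreover have "icrp (\<lambda>x y. I y \<le> I x)"
    using niveloid_translate[OF niv] by (simp add: icrp_def)
  moreover have "convexity (\<lambda>x y. I y \<le> I x)"
    unfolding convexity_def
  proof (intro ballI allI impI)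
    fix x y and \<theta> t :: real
    assume xy: "x \<in> linf" "y \<in> linf" and t: "t \<in> {0..1}" and *: "I (\<lambda>_. \<theta>) \<le> I x \<and> I (\<lambda>_. \<theta>) \<le> I y"
    have "I (\<lambda>_. \<theta>) = t * I (\<lambda>_. \<theta>) + (1 - t) * I (\<lambda>_. \<theta>)" by (simp add: algebra_simps)
    also have "\<dots> \<le> t * I x + (1 - t) * I y" using * t by (intro add_mono mult_left_mono) auto
    also have "\<dots> \<le> I (\<lambda>n. t * x n + (1 - t) * y n)" using niveloid_concave[OF niv xy, of t] t by simp
    finally show "I (\<lambda>_. \<theta>) \<le> I (\<lambda>n. t * x n + (1 - t) * y n)" .
  qed
  ultimately show ?thesis
    using niveloid_continuity[OF niv] representation_monotone_continuity[OF c I]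
      representation_ITIS[OF T c I sub] by (simp add: all_axioms_def)
qed

theorem theorem4:
  fixes T :: "(nat \<Rightarrow> real) \<Rightarrow> (nat \<Rightarrow> real)"
  assumes "cont_pos_linear T"
  shows "(\<forall>R. all_axioms T R \<longrightarrow>
            (\<exists>c I. cost_ok T c \<and> min_rep T c I \<and> const_equiv R I
                \<and> (\<forall>J. const_equiv R J \<longrightarrow> (\<forall>x\<in>linf. J x = I x))))
       \<and> (\<forall>c I. cost_ok T c \<and> min_rep T c I
                \<and> (\<forall>\<mu>\<in>Fset T. adjoint T \<mu> (\<lambda>_. 1) \<le> 1)
              \<longrightarrow> all_axioms T (\<lambda>x y. I y \<le> I x))"
  using axioms_imp_representation[OF assms] representation_imp_axioms[OF assms] by blast

end
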